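(* Let $\rho$ be a random time on $(\Omega,\mathcal F,\mathbf F,\mathbb P)$ with $\mathbb P[\rho<\infty]=1$ and with associated canonical pair $(K,L)$. For $u\in[0,1)$ let $\eta_u:=\inf\{t\ge 0: K_t\ge u\}$ (with $\inf\emptyset=\infty$) and let $\mathbb Q_u$ be the probability on $(\Omega,\mathcal F)$ given by $d\mathbb Q_u=L_{\eta_u}\,d\mathbb P$. Assume that there exist a probability $\mathbb Q$ on $(\Omega,\mathcal F)$ and a random variable $U:\Omega\to[0,1)$ such that: (i) $\mathbb Q|_{\mathcal F_{\eta_u}}=\mathbb Q_u|_{\mathcal F_{\eta_u}}$ for all $u\in[0,1)$; (ii) under $\mathbb Q$, $U$ is independent of $\mathcal F_\infty$ and has the standard uniform law. Define $$\psi:=\inf\{t\in\mathbb R_+: K_t\ge U\}=\eta_U .$$ Then $\psi$ is a randomised stopping time on $(\Omega,\mathcal F,\mathbf F,\mathbb Q)$ with associated canonical pair (under $\mathbb Q$) equal to $(K,1)$. Furthermore, for any optional process $Y$ on $(\Omega,\mathbf F)$, the finite-dimensional distributions of $Y^\rho=(Y_{\rho\wedge t})_{t\in\mathbb R_+}$ under $\mathbb P$ coincide with the finite-dimensional distributions of $Y^\psi=(Y_{\psi\wedge t})_{t\in\mathbb R_+}$ under $\mathbb Q$.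
   Context: Setting: $(\Omega,\mathcal F)$ is a measurable space with a right-continuous filtration $\mathbf F=(\mathcal F_t)_{t\in\mathbb R_+}$ (not assumed completed), $\mathcal F_\infty:=\bigvee_t\mathcal F_t\subseteq\mathcal F$ (possibly strictly), and $\mathbb P$ is a probability on $(\Omega,\mathcal F)$. Local martingales have a.s. càdlàg paths. A random time is a $[0,\infty]$-valued $\mathcal F$-measurable random variable; all random times are assumed a.s. finite under the probability considered. By convention $X_{0-}=0$ for càdlàg $X$, and integrals $\int_{\mathbb R_+}\cdot\,dK_t$ include the mass $K_0$ at $t=0$. Canonical pair: the canonical pair associated with a random time $\rho$ on $(\Omega,\mathcal F,\mathbf F,\mathbb P)$ is the (existing and essentially $\mathbb P$-unique) pair of processes $(K,L)$ such that (1) $K$ is $\mathbf F$-adapted, right-continuous, nondecreasing, $0\le K\le 1$; (2) $L$ is a nonnegative local martingale on $(\Omega,\mathbf F,\mathbb P)$ with $L_0=1$; (3) $\mathbb E_{\mathbb P}[V_\rho]=\mathbb E_{\mathbb P}\big[\int_{\mathbb R_+}V_tL_t\,dK_t\big]$ for every nonnegative optional process $V$ on $(\Omega,\mathbf F)$; (4) $\int_{\mathbb R_+}\mathbb I_{\{K_{t-}=1\}}\,dL_t=0$ and $\int_{\mathbb R_+}\mathbb I_{\{L_t=0\}}\,dK_t=0$, $\mathbb P$-a.s. Essential uniqueness: another such pair $(K',L')$ has $K'$ indistinguishable from $K$ and $\mathbb P[L_t=L'_t\ \forall t\mid K_\infty>0]=1$. The canonical pair under another probability $\mathbb Q$ is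 defined by replacing $\mathbb P$ with $\mathbb Q$. It is known that $L$ is a.s. bounded on $[0,\eta_u]$ for each $u\in[0,1)$, so $\mathbb E_{\mathbb P}[L_{\eta_u}]=1$, where $L_\infty:=\lim_{t\to\infty}L_t$ on $\{\eta_u=\infty\}$. Randomised stopping time: $\psi$ is a randomised stopping time on $(\Omega,\mathcal F,\mathbf F,\mathbb Q)$ if $\psi=\inf\{t\in\mathbb R_+: K_t\ge U\}$ ($\inf\emptyset=\infty$) for some $\mathbf F$-adapted, right-continuous, nondecreasing $K$ with $0\le K\le1$ and some $\mathcal F$-measurable $U$ that is independent of $\mathcal F_\infty$ and standard uniform under $\mathbb Q$. *)

theory Defs
  imports "HOL-Probability.Probability"
begin

text \<open>
  A filtration is indexed by \<open>[0,\<infinity>]\<close>, represented by the type \<^typ>\<open>ennreal\<close>, with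
  \<open>F \<top>\<close> the sigma-algebra generated by all \<open>F t\<close>, \<open>t < \<infinity>\<close>; with this index type
  \<^const>\<open>stopping_time\<close> and \<open>filtration.pre_sigma\<close> are the usual notions for
  \<open>[0,\<infinity>]\<close>-valued stopping times. The filtration is not assumed to be complete.
  Only the space and the sets of \<open>M\<close> matter here.
\<close>

locale right_continuous_filtration = filtration "space M" F
  for M :: "'a measure" and F :: "ennreal \<Rightarrow> 'a measure" +
  assumes sets_F_le: "sets (F \<top>) \<subseteq> sets M"
    and sets_F_top: "sets (F \<top>) = sigma_sets (space M) (\<Union>t\<in>{..<\<top>}. sets (F t))"
    and right_continuous: "t < \<top> \<Longrightarrow> sets (F t) = (\<Inter>s\<in>{t<..<\<top>}. sets (F s))"

text \<open>
  A process is a function \<open>X :: real \<Rightarrow> 'a \<Rightarrow> real\<close> of which only the values at times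
  \<open>t \<ge> 0\<close> are relevant.
\<close>

definition adapted :: "(ennreal \<Rightarrow> 'a measure) \<Rightarrow> (real \<Rightarrow> 'a \<Rightarrow> real) \<Rightarrow> bool" where
  "adapted F X \<longleftrightarrow> (\<forall>t\<ge>0. X t \<in> borel_measurable (F (ennreal t)))"

definition cadlag :: "(real \<Rightarrow> real) \<Rightarrow> bool" where
  "cadlag x \<longleftrightarrow> (\<forall>t\<ge>0. continuous (at_right t) x) \<and> (\<forall>t>0. \<exists>l. (x \<longlongrightarrow> l) (at_left t))"

definition left_limit :: "(real \<Rightarrow> real) \<Rightarrow> real \<Rightarrow> real" where
  "left_limit x t = (if t \<le> 0 then 0 else Lim (at_left t) x)"

definition optional_sigma :: "(ennreal \<Rightarrow> 'a measure) \<Rightarrow> ('a \<times> real) measure" where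
  "optional_sigma F = sigma (space (F 0) \<times> {0..})
     {{(\<omega>, t) \<in> space (F 0) \<times> {0..}. X t \<omega> \<in> B} | X B.
        adapted F X \<and> (\<forall>\<omega>\<in>space (F 0). cadlag (\<lambda>t. X t \<omega>)) \<and> B \<in> sets borel}"

definition optional_process :: "(ennreal \<Rightarrow> 'a measure) \<Rightarrow> (real \<Rightarrow> 'a \<Rightarrow> real) \<Rightarrow> bool" where
  "optional_process F Y \<longleftrightarrow> (\<lambda>(\<omega>, t). Y t \<omega>) \<in> borel_measurable (optional_sigma F)"

text \<open>The value of a process at a \<open>[0,\<infinity>]\<close>-valued random time, with \<open>X\<^sub>\<infinity> = lim X\<^sub>t\<close>.\<close>

definition value_at :: "(real \<Rightarrow> 'a \<Rightarrow> real) \<Rightarrow> ('a \<Rightarrow> ennreal) \<Rightarrow> 'a \<Rightarrow> real" where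
  "value_at X \<tau> \<omega> =
     (if \<tau> \<omega> = \<top> then Lim at_top (\<lambda>t. X t \<omega>) else X (enn2real (\<tau> \<omega>)) \<omega>)"

definition stopped :: "(real \<Rightarrow> 'a \<Rightarrow> real) \<Rightarrow> ('a \<Rightarrow> ennreal) \<Rightarrow> real \<Rightarrow> 'a \<Rightarrow> real" where
  "stopped X \<tau> t \<omega> = X (enn2real (min (\<tau> \<omega>) (ennreal t))) \<omega>"

definition random_time :: "'a measure \<Rightarrow> ('a \<Rightarrow> ennreal) \<Rightarrow> bool" where
  "random_time M \<rho> \<longleftrightarrow> \<rho> \<in> borel_measurable M \<and> (AE \<omega> in M. \<rho> \<omega> < \<top>)"

definition martingale ::
  "'a measure \<Rightarrow> (ennreal \<Rightarrow> 'a measure) \<Rightarrow> (real \<Rightarrow> 'a \<Rightarrow> real) \<Rightarrow> bool" where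
  "martingale M F X \<longleftrightarrow> adapted F X \<and> (\<forall>t\<ge>0. integrable M (X t)) \<and>
     (\<forall>s\<ge>0. \<forall>t\<ge>s. AE \<omega> in M. real_cond_exp M (F (ennreal s)) (X t) \<omega> = X s \<omega>)"

text \<open>
  Paths are cadlag only almost surely and the filtration is not complete, so that a stopped
  process need not be strictly adapted; it is therefore only required to be
  indistinguishable from a martingale.
\<close>

definition local_martingale ::
  "'a measure \<Rightarrow> (ennreal \<Rightarrow> 'a measure) \<Rightarrow> (real \<Rightarrow> 'a \<Rightarrow> real) \<Rightarrow> bool" where
  "local_martingale M F X \<longleftrightarrow> adapted F X \<and> (AE \<omega> in M. cadlag (\<lambda>t. X t \<omega>)) \<and>
     (\<exists>\<tau> :: nat \<Rightarrow> 'a \<Rightarrow> ennreal.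
        (\<forall>n. stopping_time F (\<tau> n)) \<and>
        (AE \<omega> in M. incseq (\<lambda>n. \<tau> n \<omega>) \<and> (\<lambda>n. \<tau> n \<omega>) \<longlonglongrightarrow> \<top>) \<and>
        (\<forall>n. \<exists>N. martingale M F N \<and> (AE \<omega> in M. \<forall>t\<ge>0. stopped X (\<tau> n) t \<omega> = N t \<omega>)))"

text \<open>
  Convergence in probability, uniformly on compact time intervals. The exceptional sets are
  required to be measurable, so that nothing is assumed about measurability of the suprema.
\<close>

definition ucp_limit ::
  "'a measure \<Rightarrow> (nat \<Rightarrow> real \<Rightarrow> 'a \<Rightarrow> real) \<Rightarrow> (real \<Rightarrow> 'a \<Rightarrow> real) \<Rightarrow> bool" where
  "ucp_limit M I J \<longleftrightarrow> (\<forall>T\<ge>0. \<forall>\<epsilon>>0. \<exists>A :: nat \<Rightarrow> 'a set.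
     (\<forall>n. A n \<in> sets M) \<and> (\<lambda>n. measure M (A n)) \<longlonglongrightarrow> 0 \<and>
     (\<forall>n. \<forall>\<omega>\<in>space M - A n. \<forall>t\<in>{0..T}. \<bar>I n t \<omega> - J t \<omega>\<bar> \<le> \<epsilon>))"

text \<open>
  \<open>stoch_integral M F X H J\<close>: the process \<open>J\<close> is a version of
  \<open>t \<mapsto> \<integral>\<^bsub>[0,t]\<^esub> H dX\<close>, for bounded predictable \<open>H\<close> and a semimartingale \<open>X\<close>. The stochastic
  integral is the unique linear extension of the integral of elementary predictable
  integrands that satisfies bounded convergence in the ucp sense, and the bounded
  predictable processes are the closure of the elementary ones under linear
  combinations and bounded pointwise limits; this is what the rules say. The first rule
  accounts for the mass \<open>X\<^sub>0 - X\<^sub>0\<^sub>-\<close> at time \<open>0\<close>, where \<open>X\<^sub>0\<^sub>- = 0\<close>.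
\<close>

inductive stoch_integral ::
  "'a measure \<Rightarrow> (ennreal \<Rightarrow> 'a measure) \<Rightarrow> (real \<Rightarrow> 'a \<Rightarrow> real) \<Rightarrow>
   (real \<Rightarrow> 'a \<Rightarrow> real) \<Rightarrow> (real \<Rightarrow> 'a \<Rightarrow> real) \<Rightarrow> bool"
  for M F X where
  at_zero: "Z \<in> borel_measurable (F 0) \<Longrightarrow> bounded (Z ` space M) \<Longrightarrow>
    stoch_integral M F X (\<lambda>t \<omega>. if t = 0 then Z \<omega> else 0) (\<lambda>t \<omega>. Z \<omega> * X 0 \<omega>)"
| elementary: "0 \<le> r \<Longrightarrow> r \<le> s \<Longrightarrow> Z \<in> borel_measurable (F (ennreal r)) \<Longrightarrow>
    bounded (Z ` space M) \<Longrightarrow>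
    stoch_integral M F X (\<lambda>t \<omega>. if r < t \<and> t \<le> s then Z \<omega> else 0)
      (\<lambda>t \<omega>. Z \<omega> * (X (min s t) \<omega> - X (min r t) \<omega>))"
| linear: "stoch_integral M F X H J \<Longrightarrow> stoch_integral M F X H' J' \<Longrightarrow>
    stoch_integral M F X (\<lambda>t \<omega>. a * H t \<omega> + b * H' t \<omega>) (\<lambda>t \<omega>. a * J t \<omega> + b * J' t \<omega>)"
| limit: "(\<And>n. stoch_integral M F X (Hs n) (Js n)) \<Longrightarrow>
    (\<And>n t \<omega>. 0 \<le> t \<Longrightarrow> \<omega> \<in> space M \<Longrightarrow> \<bar>Hs n t \<omega>\<bar> \<le> C) \<Longrightarrow>
    (\<And>t \<omega>. 0 \<le> t \<Longrightarrow> \<omega> \<in> space M \<Longrightarrow> (\<lambda>n. Hs n t \<omega>) \<longlonglongrightarrow> H t \<omega>) \<Longrightarrow>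
    ucp_limit M Js J \<Longrightarrow> stoch_integral M F X H J"

text \<open>\<open>\<integral>\<^bsub>[0,\<infinity>)\<^esub> H dX = 0\<close> almost surely.\<close>

definition stoch_integral_vanishes ::
  "'a measure \<Rightarrow> (ennreal \<Rightarrow> 'a measure) \<Rightarrow> (real \<Rightarrow> 'a \<Rightarrow> real) \<Rightarrow>
   (real \<Rightarrow> 'a \<Rightarrow> real) \<Rightarrow> bool" where
  "stoch_integral_vanishes M F X H \<longleftrightarrow>
     (\<exists>J. stoch_integral M F X H J \<and> (AE \<omega> in M. ((\<lambda>t. J t \<omega>) \<longlongrightarrow> 0) at_top))"

definition unit_increasing :: "(ennreal \<Rightarrow> 'a measure) \<Rightarrow> (real \<Rightarrow> 'a \<Rightarrow> real) \<Rightarrow> bool" where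
  "unit_increasing F K \<longleftrightarrow> adapted F K \<and>
     (\<forall>\<omega>\<in>space (F 0). (\<forall>t\<ge>0. continuous (at_right t) (\<lambda>t. K t \<omega>)) \<and>
        mono_on {0..} (\<lambda>t. K t \<omega>) \<and> (\<forall>t\<ge>0. 0 \<le> K t \<omega> \<and> K t \<omega> \<le> 1))"

text \<open>
  The measure \<open>dK(\<omega>)\<close> on \<open>[0,\<infinity>)\<close>, with mass \<open>K\<^sub>0(\<omega>)\<close> at \<open>0\<close> since \<open>K\<^sub>0\<^sub>- = 0\<close>.
\<close>

definition path_measure :: "(real \<Rightarrow> 'a \<Rightarrow> real) \<Rightarrow> 'a \<Rightarrow> real measure" where
  "path_measure K \<omega> = interval_measure (\<lambda>t. if t < 0 then 0 else K t \<omega>)"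

definition canonical_pair ::
  "'a measure \<Rightarrow> (ennreal \<Rightarrow> 'a measure) \<Rightarrow> ('a \<Rightarrow> ennreal) \<Rightarrow>
   (real \<Rightarrow> 'a \<Rightarrow> real) \<Rightarrow> (real \<Rightarrow> 'a \<Rightarrow> real) \<Rightarrow> bool" where
  "canonical_pair M F \<rho> K L \<longleftrightarrow>
     random_time M \<rho> \<and>
     unit_increasing F K \<and>
     local_martingale M F L \<and> (AE \<omega> in M. \<forall>t\<ge>0. 0 \<le> L t \<omega>) \<and> (AE \<omega> in M. L 0 \<omega> = 1) \<and>
     (\<forall>V. optional_process F V \<and> (\<forall>t\<ge>0. \<forall>\<omega>\<in>space M. 0 \<le> V t \<omega>) \<longrightarrow>
        (\<integral>\<^sup>+\<omega>. ennreal (value_at V \<rho> \<omega>) \<partial>M) =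
        (\<integral>\<^sup>+\<omega>. (\<integral>\<^sup>+t. ennreal (V t \<omega> * L t \<omega>) \<partial>path_measure K \<omega>) \<partial>M)) \<and>
     stoch_integral_vanishes M F L (\<lambda>t \<omega>. if left_limit (\<lambda>s. K s \<omega>) t = 1 then 1 else 0) \<and>
     (AE \<omega> in M. (\<integral>\<^sup>+t. indicator {t. L t \<omega> = 0} t \<partial>path_measure K \<omega>) = 0)"

definition hit :: "(real \<Rightarrow> 'a \<Rightarrow> real) \<Rightarrow> real \<Rightarrow> 'a \<Rightarrow> ennreal" where
  "hit K u \<omega> = Inf (ennreal ` {t. 0 \<le> t \<and> u \<le> K t \<omega>})"

definition independent_uniform ::
  "'a measure \<Rightarrow> (ennreal \<Rightarrow> 'a measure) \<Rightarrow> ('a \<Rightarrow> real) \<Rightarrow> bool" where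
  "independent_uniform M F U \<longleftrightarrow> U \<in> borel_measurable M \<and>
     prob_space.indep_set M {U -` B \<inter> space M | B. B \<in> sets borel} (sets (F \<top>)) \<and>
     distr M lborel U = uniform_measure lborel {0..1}"

definition randomised_stopping_time ::
  "'a measure \<Rightarrow> (ennreal \<Rightarrow> 'a measure) \<Rightarrow> ('a \<Rightarrow> ennreal) \<Rightarrow> bool" where
  "randomised_stopping_time M F \<psi> \<longleftrightarrow>
     (\<exists>K U. unit_increasing F K \<and> independent_uniform M F U \<and>
        (\<forall>\<omega>\<in>space M. \<psi> \<omega> = hit K (U \<omega>) \<omega>))"

definition same_fdd ::
  "'a measure \<Rightarrow> (real \<Rightarrow> 'a \<Rightarrow> real) \<Rightarrow> 'b measure \<Rightarrow> (real \<Rightarrow> 'b \<Rightarrow> real) \<Rightarrow> bool" where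
  "same_fdd M X N Y \<longleftrightarrow> (\<forall>J\<subseteq>{0..}. finite J \<longrightarrow>
     distr M (\<Pi>\<^sub>M t\<in>J. borel) (\<lambda>\<omega>. \<lambda>t\<in>J. X t \<omega>) = distr N (\<Pi>\<^sub>M t\<in>J. borel) (\<lambda>\<omega>. \<lambda>t\<in>J. Y t \<omega>))"

end

theory Submission
  imports Defs
begin

text \<open>
  Pathwise, the substitution \<open>t = \<eta>\<^sub>u\<close> gives \<open>\<integral> f dK = \<integral>\<^sub>0\<^sup>1 f(\<eta>\<^sub>u) 1{\<eta>\<^sub>u < \<infinity>} du\<close>. For a nonnegative
  optional process \<open>V\<close> the variable \<open>V(\<eta>\<^sub>u) 1{\<eta>\<^sub>u < \<infinity>}\<close> is measurable at \<open>\<eta>\<^sub>u\<close>, so Tonelli and the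
  agreement of \<open>Q\<close> with \<open>L(\<eta>\<^sub>u) P\<close> there show that \<open>E\<^sub>P[\<integral> V L dK]\<close> is the integral over \<open>u\<close> in
  \<open>(0,1)\<close> of \<open>E\<^sub>Q[V(\<eta>\<^sub>u) 1{\<eta>\<^sub>u < \<infinity>}]\<close>. The latter equals \<open>E\<^sub>Q[\<integral> V dK]\<close> by the same
  substitution, and \<open>E\<^sub>Q[V(\<psi>) 1{\<psi> < \<infinity>}]\<close> since \<open>U\<close> is uniform and independent of \<open>F\<^sub>\<infinity>\<close>. Taking
  \<open>V = 1\<close> gives \<open>\<psi> < \<infinity>\<close> almost surely under \<open>Q\<close>; taking \<open>V\<close> to be an indicator of finitely many
  values of \<open>Y\<close> stopped at the running time gives the finite-dimensional distributions.
\<close>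

section \<open>Optional processes\<close>

text \<open>The optional sigma-algebra is generated by the level sets of adapted cadlag processes,
  so measurability of a map into it can be tested on these sets. This is how the statements about
  general optional processes below are reduced to cadlag paths.\<close>

lemma measurable_optional_sigmaI:
  assumes space: "\<And>x. x \<in> space N \<Longrightarrow> fst (g x) \<in> space (F 0) \<and> 0 \<le> snd (g x)"
    and meas: "\<And>X. adapted F X \<Longrightarrow> (\<And>\<omega>. \<omega> \<in> space (F 0) \<Longrightarrow> cadlag (\<lambda>t. X t \<omega>)) \<Longrightarrow>
      (\<lambda>x. X (snd (g x)) (fst (g x))) \<in> borel_measurable N"
  shows "g \<in> N \<rightarrow>\<^sub>M optional_sigma F"
  unfolding optional_sigma_def
proof (rule measurable_measure_of)
  show "g \<in> space N \<rightarrow> space (F 0) \<times> {0..}"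
    using space by (auto simp: mem_Times_iff)
next
  fix A assume "A \<in> {{(\<omega>, t) \<in> space (F 0) \<times> {0..}. X t \<omega> \<in> B} | X B.
        adapted F X \<and> (\<forall>\<omega>\<in>space (F 0). cadlag (\<lambda>t. X t \<omega>)) \<and> B \<in> sets borel}"
  then obtain X B where A: "A = {(\<omega>, t) \<in> space (F 0) \<times> {0..}. X t \<omega> \<in> B}"
    and X: "adapted F X" "\<And>\<omega>. \<omega> \<in> space (F 0) \<Longrightarrow> cadlag (\<lambda>t. X t \<omega>)" and B: "B \<in> sets borel"
    by blast
  have "g -` A \<inter> space N = (\<lambda>x. X (snd (g x)) (fst (g x))) -` B \<inter> space N"
    using space by (auto simp: A split_beta mem_Times_iff)
  then show "g -` A \<inter> space N \<in> sets N"
    using measurable_sets[OF meas[OF X] B] by simp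
qed auto

lemma space_optional_sigma [simp]: "space (optional_sigma F) = space (F 0) \<times> {0..}"
  unfolding optional_sigma_def by (rule space_measure_of) auto

lemma optional_process_cadlag:
  assumes X: "adapted F X" "\<And>\<omega>. \<omega> \<in> space (F 0) \<Longrightarrow> cadlag (\<lambda>t. X t \<omega>)"
  shows "optional_process F X"
  unfolding optional_process_def
proof (rule measurableI)
  fix B :: "real set" assume B: "B \<in> sets borel"
  have "(\<lambda>(\<omega>, t). X t \<omega>) -` B \<inter> space (optional_sigma F) =
      {(\<omega>, t) \<in> space (F 0) \<times> {0..}. X t \<omega> \<in> B}"
    by auto
  also have "\<dots> \<in> sets (optional_sigma F)"
    unfolding optional_sigma_def
  proof (rule in_measure_of)
    show "{(\<omega>, t) \<in> space (F 0) \<times> {0..}. X t \<omega> \<in> B} \<in>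
      {{(\<omega>, t) \<in> space (F 0) \<times> {0..}. X t \<omega> \<in> B} | X B.
        adapted F X \<and> (\<forall>\<omega>\<in>space (F 0). cadlag (\<lambda>t. X t \<omega>)) \<and> B \<in> sets borel}"
      by (intro CollectI exI[of _ X] exI[of _ B] conjI ballI refl X B)
  qed auto
  finally show "(\<lambda>(\<omega>, t). X t \<omega>) -` B \<inter> space (optional_sigma F) \<in> sets (optional_sigma F)" .
qed simp

lemma cadlag_at_right: "cadlag x \<Longrightarrow> 0 \<le> t \<Longrightarrow> continuous (at_right t) x"
  by (simp add: cadlag_def)

lemma at_right_min:
  assumes "\<And>r. 0 \<le> r \<Longrightarrow> continuous (at_right r) x" "0 \<le> t" "0 \<le> r"
  shows "continuous (at_right r) (\<lambda>s. x (min s t :: real) :: real)"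
proof (cases "r < t")
  case True
  have "((\<lambda>s. x (min s t)) \<longlongrightarrow> x r) (at_right r)"
    using assms(1)[OF \<open>0 \<le> r\<close>] unfolding continuous_within
    by (rule Lim_transform_eventually)
      (use eventually_at_right_real[OF True] in \<open>auto elim!: eventually_mono\<close>)
  then show ?thesis using True by (simp add: continuous_within)
next
  case False
  then have "\<forall>\<^sub>F s in at_right r. x t = x (min s t)"
    by (intro eventually_at_rightI[of r "r + 1"]) auto
  then have "((\<lambda>s. x (min s t)) \<longlongrightarrow> x t) (at_right r)"
    by (rule Lim_transform_eventually[OF tendsto_const])
  moreover have "min r t = t" using False by simp
  ultimately show ?thesis by (simp add: continuous_within)
qed

lemma cadlag_min:
  assumes x: "cadlag x" and t: "0 \<le> t"
  shows "cadlag (\<lambda>s. x (min s t))"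
  unfolding cadlag_def
proof (intro conjI allI impI)
  fix r :: real assume "0 \<le> r"
  then show "continuous (at_right r) (\<lambda>s. x (min s t))"
    using at_right_min cadlag_at_right[OF x] t by blast
next
  fix r :: real assume r: "0 < r"
  show "\<exists>l. ((\<lambda>s. x (min s t)) \<longlongrightarrow> l) (at_left r)"
  proof (cases "r \<le> t")
    case True
    obtain l where "(x \<longlongrightarrow> l) (at_left r)" using x r by (auto simp: cadlag_def)
    moreover have "\<forall>\<^sub>F s in at_left r. x s = x (min s t)"
      using True by (intro eventually_at_leftI[of 0 r]) (auto simp: r)
    ultimately show ?thesis by (blast intro: Lim_transform_eventually)
  next
    case False
    then have "\<forall>\<^sub>F s in at_left r. x t = x (min s t)"
      by (intro eventually_at_leftI[of t r]) auto
    then show ?thesis by (blast intro: Lim_transform_eventually[OF tendsto_const])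
  qed
qed

text \<open>The point used is the first one of the grid of mesh 1/(n+1) strictly to the right of
  \<open>s\<close>: floor plus one, not ceiling, because convergence along \<open>at_right s\<close>
  must avoid \<open>s\<close> itself.\<close>

lemma grid_tendsto_at_right:
  "filterlim (\<lambda>n. (of_int \<lfloor>real (Suc n) * s\<rfloor> + 1) / real (Suc n)) (at_right s) sequentially"
proof -
  have gt: "s < (of_int \<lfloor>real (Suc n) * s\<rfloor> + 1) / real (Suc n)" for n
    proof -
    have "real (Suc n) * s < of_int \<lfloor>real (Suc n) * s\<rfloor> + 1" by linarith
    then show ?thesis by (simp add: pos_less_divide_eq mult.commute del: of_nat_Suc)
  qed
  have le: "(of_int \<lfloor>real (Suc n) * s\<rfloor> + 1) / real (Suc n) \<le> s + 1 / real (Suc n)" for n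
    proof -
    have "of_int \<lfloor>real (Suc n) * s\<rfloor> + 1 \<le> (s + 1 / real (Suc n)) * real (Suc n)"
      by (simp add: distrib_right mult.commute[of s] del: of_nat_Suc)
    then show ?thesis by (simp add: pos_divide_le_eq del: of_nat_Suc)
  qed
  have "(\<lambda>n. (of_int \<lfloor>real (Suc n) * s\<rfloor> + 1) / real (Suc n)) \<longlonglongrightarrow> s"
  proof (rule real_tendsto_sandwich[OF _ _ tendsto_const])
    show "(\<lambda>n. s + 1 / real (Suc n)) \<longlonglongrightarrow> s"
      using tendsto_add[OF tendsto_const LIMSEQ_Suc[OF lim_1_over_n], of s] by simp
  qed (use gt le in \<open>blast intro: always_eventually less_imp_le\<close>)+
  then show ?thesis
    unfolding filterlim_at
    using gt by (intro conjI always_eventually) (auto simp del: of_nat_Suc simp: less_imp_neq[symmetric])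
qed

text \<open>Approximating the random time \<open>g\<close> from the right by grid values reduces the
  claim to times with countably many values, and right-continuity gives the limit. The point of the
  path is \<open>f x\<close> and not \<open>x\<close>, so that the lemma also applies on product
  spaces.\<close>

lemma measurable_right_continuous_process:
  fixes X :: "real \<Rightarrow> 'a \<Rightarrow> real"
  assumes meas: "\<And>r. 0 \<le> r \<Longrightarrow> X r \<in> borel_measurable M"
    and cont: "\<And>\<omega> r. \<omega> \<in> space M \<Longrightarrow> 0 \<le> r \<Longrightarrow> continuous (at_right r) (\<lambda>t. X t \<omega>)"
    and f [measurable]: "f \<in> N \<rightarrow>\<^sub>M M" and g [measurable]: "g \<in> borel_measurable N"
    and g0: "\<And>x. x \<in> space N \<Longrightarrow> 0 \<le> g x"
  shows "(\<lambda>x. X (g x) (f x)) \<in> borel_measurable N"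
proof (rule borel_measurable_LIMSEQ_metric)
  fix n :: nat
  \<comment> \<open>The integer \<open>i\<close> may be negative, whereas \<open>X r\<close> is
    known to be measurable only for nonnegative \<open>r\<close>. The truncation by
    \<open>max 0\<close> repairs this and changes nothing along the approximation of
    \<open>g x\<close>, which is nonnegative.\<close>
  have "(\<lambda>x. X (max 0 ((of_int i + 1) / real (Suc n))) (f x)) \<in> borel_measurable N" for i
    by (rule measurable_compose[OF f meas]) simp
  then have "(\<lambda>x. X (max 0 ((of_int \<lfloor>real (Suc n) * g x\<rfloor> + 1) / real (Suc n))) (f x))
    \<in> borel_measurable N"
    by (rule measurable_compose_countable) measurable
  then show "(\<lambda>x. X (max 0 ((of_int \<lfloor>real (Suc n) * g x\<rfloor> + 1) / real (Suc n))) (f x))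
    \<in> borel_measurable N" .
next
  fix x assume x: "x \<in> space N"
  have "0 \<le> (of_int \<lfloor>real (Suc n) * g x\<rfloor> + 1) / real (Suc n)" for n
    using g0[OF x] by (intro divide_nonneg_nonneg add_nonneg_nonneg) auto
  then have "max 0 ((of_int \<lfloor>real (Suc n) * g x\<rfloor> + 1) / real (Suc n))
      = (of_int \<lfloor>real (Suc n) * g x\<rfloor> + 1) / real (Suc n)" for n
    by (rule max_absorb2)
  moreover have "((\<lambda>t. X t (f x)) \<longlongrightarrow> X (g x) (f x)) (at_right (g x))"
    using cont[OF measurable_space[OF f x] g0[OF x]] by (simp add: continuous_within)
  note filterlim_compose[OF this grid_tendsto_at_right]
  ultimately show "(\<lambda>n. X (max 0 ((of_int \<lfloor>real (Suc n) * g x\<rfloor> + 1) / real (Suc n))) (f x))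
      \<longlonglongrightarrow> X (g x) (f x)"
    by simp
qed

section \<open>Measurability of optional processes at random and stopping times\<close>

context right_continuous_filtration
begin

lemma measurable_F_mono: "s \<le> t \<Longrightarrow> f \<in> F s \<rightarrow>\<^sub>M N \<Longrightarrow> f \<in> F t \<rightarrow>\<^sub>M N"
  using sets_F_mono[of s t] by (auto simp: measurable_def space_F)

lemma measurable_F_M: "f \<in> F t \<rightarrow>\<^sub>M N \<Longrightarrow> f \<in> M \<rightarrow>\<^sub>M N"
  using sets_F_mono[of t \<top>] sets_F_le by (auto simp: measurable_def space_F)

lemma measurable_optional_sigma:
  assumes f: "f \<in> N \<rightarrow>\<^sub>M F \<top>" and g: "g \<in> borel_measurable N" "\<And>x. x \<in> space N \<Longrightarrow> 0 \<le> g x"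
  shows "(\<lambda>x. (f x, g x)) \<in> N \<rightarrow>\<^sub>M optional_sigma F"
proof (rule measurable_optional_sigmaI)
  show "fst (f x, g x) \<in> space (F 0) \<and> 0 \<le> snd (f x, g x)" if "x \<in> space N" for x
    using measurable_space[OF f that] g(2)[OF that] by (simp add: space_F)
next
  fix X assume X: "adapted F X" "\<And>\<omega>. \<omega> \<in> space (F 0) \<Longrightarrow> cadlag (\<lambda>t. X t \<omega>)"
  have "(\<lambda>x. X (g x) (f x)) \<in> borel_measurable N"
  proof (rule measurable_right_continuous_process[OF _ _ f g])
    show "X r \<in> borel_measurable (F \<top>)" if "0 \<le> r" for r
      using X(1) that by (auto simp: adapted_def intro: measurable_F_mono[of "ennreal r"])
  qed (use X(2) cadlag_at_right in \<open>auto simp: space_F\<close>)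
  then show "(\<lambda>x. X (snd (f x, g x)) (fst (f x, g x))) \<in> borel_measurable N" by simp
qed

text \<open>A cadlag adapted process stopped at a constant time is again cadlag and adapted. This
  makes functionals of finitely many values of a stopped optional process optional in the running
  time.\<close>

lemma measurable_min_optional_sigma:
  assumes "0 \<le> t"
  shows "(\<lambda>x. (fst x, min (snd x) t)) \<in> optional_sigma F \<rightarrow>\<^sub>M optional_sigma F"
proof (rule measurable_optional_sigmaI)
  fix X assume X: "adapted F X" "\<And>\<omega>. \<omega> \<in> space (F 0) \<Longrightarrow> cadlag (\<lambda>t. X t \<omega>)"
  let ?X = "\<lambda>s. X (min s t)"
  have ad: "adapted F ?X"
    unfolding adapted_def
  proof (intro allI impI)
    fix s :: real assume "0 \<le> s"
    then show "?X s \<in> borel_measurable (F (ennreal s))"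
      using X(1) \<open>0 \<le> t\<close> by (intro measurable_F_mono[of "ennreal (min s t)" "ennreal s"])
        (auto simp: adapted_def intro!: ennreal_leI)
  qed
  have cad: "cadlag (\<lambda>s. ?X s \<omega>)" if "\<omega> \<in> space (F 0)" for \<omega>
    using cadlag_min[OF X(2)[OF that] \<open>0 \<le> t\<close>] .
  have "(\<lambda>(\<omega>, s). ?X s \<omega>) \<in> borel_measurable (optional_sigma F)"
    using optional_process_cadlag[OF ad cad] by (simp add: optional_process_def)
  also have "(\<lambda>(\<omega>, s). ?X s \<omega>) =
      (\<lambda>x. X (snd (fst x, min (snd x) t)) (fst (fst x, min (snd x) t)))"
    by auto
  finally show "(\<lambda>x. X (snd (fst x, min (snd x) t)) (fst (fst x, min (snd x) t)))
    \<in> borel_measurable (optional_sigma F)" .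
qed (use assms in auto)

text \<open>This is the fact that an optional process evaluated at a stopping time is measurable at
  that time: on the event that \<tau> is at most \<open>t\<close>, it coincides with its minimum
  with \<open>t\<close>, and only path values up to \<open>t\<close> enter. Where \<tau> is
  infinite, \<open>enn2real\<close> gives 0, so the value there is the one at time 0.\<close>

lemma measurable_pre_sigma_optional_sigma:
  assumes \<tau>: "stopping_time F \<tau>"
  shows "(\<lambda>\<omega>. (\<omega>, enn2real (\<tau> \<omega>))) \<in> pre_sigma \<tau> \<rightarrow>\<^sub>M optional_sigma F"
proof (rule measurable_optional_sigmaI)
  fix X assume X: "adapted F X" "\<And>\<omega>. \<omega> \<in> space (F 0) \<Longrightarrow> cadlag (\<lambda>t. X t \<omega>)"
  have "(\<lambda>\<omega>. X (enn2real (\<tau> \<omega>)) \<omega>) \<in> borel_measurable (pre_sigma \<tau>)"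
  proof (intro measurableI sets_pre_sigmaI[OF \<tau>])
    fix B :: "real set" and t :: ennreal assume B: "B \<in> sets borel"
    have *: "(\<lambda>\<omega>. min (\<tau> \<omega>) t) \<in> borel_measurable (F t)"
    proof (rule borel_measurableI_le)
      fix s
      show "{\<omega> \<in> space (F t). min (\<tau> \<omega>) t \<le> s} \<in> sets (F t)"
      proof (cases "t \<le> s")
        case True
        then have "{\<omega> \<in> space (F t). min (\<tau> \<omega>) t \<le> s} = space (F t)"
          by (auto intro: min.coboundedI2)
        then show ?thesis by simp
      next
        case False
        then have "{\<omega> \<in> space (F t). min (\<tau> \<omega>) t \<le> s} = {\<omega> \<in> space (F t). \<tau> \<omega> \<le> s}"
          by (auto simp: min_le_iff_disj)
        then show ?thesis
          using stopping_time_le_const[OF \<tau>, of s t] False by (simp add: pred_def)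
      qed
    qed
    have "(\<lambda>\<omega>. X (enn2real (min (\<tau> \<omega>) t)) \<omega>) \<in> borel_measurable (F t)"
    proof (cases t)
      case (real r)
      \<comment> \<open>The approximation from the right looks beyond the random time, hence
        possibly beyond \<open>r\<close>. Freezing \<open>X\<close> at \<open>r\<close> keeps all
        approximating values measurable with respect to \<open>F t\<close>.\<close>
      have "(\<lambda>\<omega>. X (min (enn2real (min (\<tau> \<omega>) t)) r) \<omega>) \<in> borel_measurable (F t)"
      proof (rule measurable_right_continuous_process[where X="\<lambda>s. X (min s r)" and M="F t"])
        show "X (min s r) \<in> borel_measurable (F t)" if "0 \<le> s" for s
          using X(1) real that by (intro measurable_F_mono[of "ennreal (min s r)" t])
            (auto simp: adapted_def intro!: ennreal_leI)
        show "continuous (at_right s) (\<lambda>s. X (min s r) \<omega>)" if "\<omega> \<in> space (F t)" "0 \<le> s" for s \<omega>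
          using at_right_min[OF cadlag_at_right[OF X(2)]] that real by (simp add: space_F)
      qed (use * in \<open>auto intro: measurable_compose[OF *]\<close>)
      moreover have "min (enn2real (min (\<tau> \<omega>) t)) r = enn2real (min (\<tau> \<omega>) t)" for \<omega>
        using real by (intro min_absorb1) (simp add: enn2real_leI)
      ultimately show ?thesis by simp
    next
      case top
      show ?thesis
        unfolding top
      proof (rule measurable_right_continuous_process[where X=X and M="F \<top>"])
        show "X r \<in> borel_measurable (F \<top>)" if "0 \<le> r" for r
          using X(1) that by (auto simp: adapted_def intro: measurable_F_mono[of "ennreal r"])
      qed (use X(2) cadlag_at_right *[unfolded top] in \<open>auto simp: space_F\<close>)
    qed
    then have "{\<omega> \<in> space (F t). X (enn2real (min (\<tau> \<omega>) t)) \<omega> \<in> B \<and> \<tau> \<omega> \<le> t} \<in> sets (F t)"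
      using stopping_timeD[OF \<tau>, of t] B by (auto intro: measurable_sets_Collect)
    also have "{\<omega> \<in> space (F t). X (enn2real (min (\<tau> \<omega>) t)) \<omega> \<in> B \<and> \<tau> \<omega> \<le> t} =
      {\<omega> \<in> (\<lambda>\<omega>. X (enn2real (\<tau> \<omega>)) \<omega>) -` B \<inter> space (pre_sigma \<tau>). \<tau> \<omega> \<le> t}"
      by (auto simp: min_absorb1 space_F space_pre_sigma)
    finally show "{\<omega> \<in> (\<lambda>\<omega>. X (enn2real (\<tau> \<omega>)) \<omega>) -` B \<inter> space (pre_sigma \<tau>). \<tau> \<omega> \<le> t}
      \<in> sets (F t)" .
  qed auto
  then show "(\<lambda>\<omega>. X (snd (\<omega>, enn2real (\<tau> \<omega>))) (fst (\<omega>, enn2real (\<tau> \<omega>))))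
    \<in> borel_measurable (pre_sigma \<tau>)" by simp
qed (simp add: space_F space_pre_sigma)

end

section \<open>Hitting times and the change of time\<close>

text \<open>Right-continuity makes the infimum attained: if it is at most \<open>t\<close>, then
  monotonicity puts \<open>K\<close> above \<open>u\<close> at all times after \<open>t\<close>, and
  the limit from the right gives the same at \<open>t\<close>. Through this equivalence
  \<open>hit K\<close> is the generalised inverse of \<open>K\<close>.\<close>

lemma hit_le_iff:
  assumes K: "unit_increasing F K" and \<omega>: "\<omega> \<in> space (F 0)" and t: "0 \<le> t"
  shows "hit K u \<omega> \<le> ennreal t \<longleftrightarrow> u \<le> K t \<omega>"
proof
  assume "u \<le> K t \<omega>"
  then show "hit K u \<omega> \<le> ennreal t"
    using t unfolding hit_def by (intro Inf_lower) auto
next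
  assume hit: "hit K u \<omega> \<le> ennreal t"
  have mono: "mono_on {0..} (\<lambda>t. K t \<omega>)" and "continuous (at_right t) (\<lambda>t. K t \<omega>)"
    using K \<omega> t by (auto simp: unit_increasing_def)
  then have "((\<lambda>t. K t \<omega>) \<longlongrightarrow> K t \<omega>) (at_right t)" by (simp add: continuous_within)
  moreover have "\<forall>\<^sub>F s in at_right t. u \<le> K s \<omega>"
  proof (intro eventually_at_rightI[of t "t + 1"])
    fix s assume s: "s \<in> {t<..<t + 1}"
    then have "hit K u \<omega> < ennreal s"
      using hit t by (intro le_less_trans[OF hit] ennreal_lessI) auto
    then obtain r where "0 \<le> r" "u \<le> K r \<omega>" "r < s"
      using s t unfolding hit_def Inf_less_iff by (auto simp: ennreal_less_iff)
    then show "u \<le> K s \<omega>"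
      using mono_onD[OF mono, of r s] s t by auto
  qed simp
  ultimately show "u \<le> K t \<omega>"
    by (rule tendsto_lowerbound) simp
qed

context right_continuous_filtration
begin

lemma stopping_time_hit:
  assumes K: "unit_increasing F K"
  shows "stopping_time F (hit K u)"
proof
  fix t
  show "Measurable.pred (F t) (\<lambda>\<omega>. hit K u \<omega> \<le> t)"
  proof (cases t)
    case (real r)
    have [measurable]: "K r \<in> borel_measurable (F t)"
      using K real by (simp add: unit_increasing_def adapted_def)
    have "Measurable.pred (F t) (\<lambda>\<omega>. u \<le> K r \<omega>)" by measurable
    then show ?thesis
      by (rule measurable_cong[THEN iffD1, rotated])
        (use hit_le_iff[OF K _ real(1)] real in \<open>auto simp: space_F\<close>)
  qed simp
qed

text \<open>The level may vary with the point, which covers the pairs of a level and an outcome in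
  Tonelli's theorem as well as the random level \<open>U\<close>.\<close>

lemma measurable_hit:
  assumes K: "unit_increasing F K" and f: "f \<in> N \<rightarrow>\<^sub>M F \<top>" and g [measurable]: "g \<in> borel_measurable N"
  shows "(\<lambda>x. hit K (g x) (f x)) \<in> borel_measurable N"
proof (rule borel_measurableI_le)
  fix t
  show "{x \<in> space N. hit K (g x) (f x) \<le> t} \<in> sets N"
  proof (cases t)
    case (real r)
    have "K r \<in> borel_measurable (F \<top>)"
      using K real by (auto simp: unit_increasing_def adapted_def intro: measurable_F_mono[of "ennreal r"])
    note [measurable] = measurable_compose[OF f this]
    have "{x \<in> space N. g x \<le> K r (f x)} \<in> sets N"
      by measurable
    also have "{x \<in> space N. g x \<le> K r (f x)} = {x \<in> space N. hit K (g x) (f x) \<le> t}"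
      using hit_le_iff[OF K _ real(1)] real measurable_space[OF f] by (auto simp: space_F)
    finally show ?thesis .
  qed simp
qed

lemma measurable_optional_process:
  assumes V: "optional_process F V"
    and f: "f \<in> N \<rightarrow>\<^sub>M F \<top>" and g: "g \<in> borel_measurable N" "\<And>x. x \<in> space N \<Longrightarrow> 0 \<le> g x"
  shows "(\<lambda>x. V (g x) (f x)) \<in> borel_measurable N"
  using measurable_compose[OF measurable_optional_sigma[OF f g] V[unfolded optional_process_def]]
  by simp

end

text \<open>The measure \<open>dK\<close> is the image of Lebesgue measure under the generalised
  inverse of \<open>K\<close>: both sides give \<open>{a<..b}\<close> the increment of
  \<open>K\<close> over it. Levels \<open>u\<close> at most 0 are excluded because they are all hit
  at time 0; the levels in \<open>{0<..K 0 \<omega>}\<close> produce the atom at 0.\<close>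

lemma path_measure_eq_distr:
  assumes K: "unit_increasing F K" and \<omega>: "\<omega> \<in> space (F 0)"
    and hit [measurable]: "(\<lambda>u. hit K u \<omega>) \<in> borel_measurable borel"
  shows "path_measure K \<omega> =
    distr (density lborel (indicator {u. 0 < u \<and> hit K u \<omega> < \<top>})) borel (\<lambda>u. enn2real (hit K u \<omega>))"
    (is "_ = ?N")
proof -
  let ?G = "\<lambda>t. if t < 0 then 0 else K t \<omega>"
  let ?S = "{u. 0 < u \<and> hit K u \<omega> < \<top>}"
  have [measurable]: "?S \<in> sets borel" by measurable
  have mono: "mono_on {0..} (\<lambda>t. K t \<omega>)" and bnd: "0 \<le> t \<Longrightarrow> 0 \<le> K t \<omega> \<and> K t \<omega> \<le> 1"
    and cont: "0 \<le> t \<Longrightarrow> continuous (at_right t) (\<lambda>t. K t \<omega>)" for t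
    using K \<omega> by (auto simp: unit_increasing_def)
  have G_mono: "?G x \<le> ?G y" if "x \<le> y" for x y
    using that bnd mono_onD[OF mono, of x y] by auto
  have G_cont: "continuous (at_right a) ?G" for a
  proof (cases "a < 0")
    case True
    then have "\<forall>\<^sub>F s in at_right a. 0 = ?G s"
      by (intro eventually_at_rightI[of a 0]) auto
    then have "(?G \<longlongrightarrow> 0) (at_right a)"
      by (rule Lim_transform_eventually[OF tendsto_const])
    then show ?thesis using True by (simp add: continuous_within)
  next
    case False
    have "\<forall>\<^sub>F s in at_right a. K s \<omega> = ?G s"
      using False by (intro eventually_at_rightI[of a "a + 1"]) auto
    moreover have "((\<lambda>t. K t \<omega>) \<longlongrightarrow> K a \<omega>) (at_right a)"
      using cont[of a] False by (simp add: continuous_within)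
    ultimately have "(?G \<longlongrightarrow> K a \<omega>) (at_right a)"
      by (rule Lim_transform_eventually[rotated])
    then show ?thesis using False by (simp add: continuous_within)
  qed
  \<comment> \<open>For negative \<open>b\<close> both sides are false: times are nonnegative, and
    the path extended by 0 stays below the positive level \<open>u\<close>.\<close>
  have le_iff: "enn2real (hit K u \<omega>) \<le> b \<longleftrightarrow> u \<le> ?G b" if u: "0 < u" "hit K u \<omega> < \<top>" for u b
  proof (cases "0 \<le> b")
    case True
    then have "enn2real (hit K u \<omega>) \<le> b \<longleftrightarrow> hit K u \<omega> \<le> ennreal b"
      using u(2) by (cases "hit K u \<omega>") auto
    then show ?thesis using True hit_le_iff[OF K \<omega> True] by simp
  next
    case False
    moreover from this have "b < enn2real (hit K u \<omega>)"
      using enn2real_nonneg[of "hit K u \<omega>"] by linarith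
    ultimately show ?thesis using u(1) by simp
  qed
  have fin: "hit K u \<omega> < \<top>" if "u \<le> ?G b" "0 < u" for u b
    using that hit_le_iff[OF K \<omega>, of b u]
    by (auto simp: not_less split: if_splits intro: le_less_trans[OF _ ennreal_less_top])
  have Ioc: "emeasure (path_measure K \<omega>) {a<..b} = emeasure ?N {a<..b}" if "a \<le> b" for a b
  proof -
    have G0: "0 \<le> ?G a" using bnd by auto
    have eq: "{u. a < enn2real (hit K u \<omega>) \<and> enn2real (hit K u \<omega>) \<le> b} \<inter> ?S = {?G a<..?G b}"
    proof safe
      fix u assume "u \<in> {?G a<..?G b}"
      with G0 have u: "0 < u" "?G a < u" "u \<le> ?G b" by auto
      show "0 < u" "hit K u \<omega> < \<top>" using u fin by blast+
      then show "a < enn2real (hit K u \<omega>)" "enn2real (hit K u \<omega>) \<le> b"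
        using le_iff[of u a] le_iff[of u b] u by linarith+
    next
      fix u assume "a < enn2real (hit K u \<omega>)" "enn2real (hit K u \<omega>) \<le> b" "0 < u" "hit K u \<omega> < \<top>"
      then show "u \<in> {?G a<..?G b}"
        using le_iff[of u a] le_iff[of u b] by auto
    qed
    have "emeasure ?N {a<..b} = (\<integral>\<^sup>+u. indicator ?S u *
        indicator {u. a < enn2real (hit K u \<omega>) \<and> enn2real (hit K u \<omega>) \<le> b} u \<partial>lborel)"
      by (simp add: emeasure_distr emeasure_density vimage_def greaterThanAtMost_def
          greaterThan_def atMost_def Int_def)
    also have "\<dots> = (\<integral>\<^sup>+u. indicator {?G a<..?G b} u \<partial>lborel)"
      unfolding eq[symmetric] by (intro nn_integral_cong) (auto split: split_indicator)
    also have "\<dots> = ennreal (?G b - ?G a)"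
      using G_mono[OF that] by simp
    also have "\<dots> = emeasure (path_measure K \<omega>) {a<..b}"
      unfolding path_measure_def
      by (rule emeasure_interval_measure_Ioc[symmetric, OF that G_mono G_cont])
    finally show ?thesis by simp
  qed
  show ?thesis
  proof (rule measure_eqI_generator_eq)
    let ?E = "(\<lambda>(a, b). {a<..b::real}) ` {(a, b). a \<le> b}"
    show "Int_stable ?E"
    proof (intro Int_stableI)
      fix A B assume "A \<in> ?E" "B \<in> ?E"
      then obtain a b c d where "A = {a<..b}" "B = {c<..d}" by auto
      \<comment> \<open>The outer maximum keeps the end points ordered when the intersection is
        empty, as membership in \<open>?E\<close> demands.\<close>
      then have "A \<inter> B = {max a c<..max (max a c) (min b d)}" by auto
      then show "A \<inter> B \<in> ?E" by (auto intro!: image_eqI[of _ _ "(max a c, max (max a c) (min b d))"])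
    qed
    show "sets (path_measure K \<omega>) = sigma_sets UNIV ?E"
      by (simp add: path_measure_def sets_extend_measure interval_measure_def)
    then show "sets ?N = sigma_sets UNIV ?E"
      by (simp add: path_measure_def)
    show "range (\<lambda>i. {- real i<..real i}) \<subseteq> ?E" by auto
    show "(\<Union>i. {- real i<..real i}) = UNIV"
    proof safe
      fix x :: real
      obtain i :: nat where "\<bar>x\<bar> < real i" using reals_Archimedean2 by blast
      then show "x \<in> (\<Union>i. {- real i<..real i})" by (intro UN_I[of i]) auto
    qed simp
    show "emeasure (path_measure K \<omega>) {- real i<..real i} \<noteq> \<infinity>" for i
      unfolding path_measure_def by (subst emeasure_interval_measure_Ioc[OF _ G_mono G_cont]) auto
  qed (use Ioc in auto)
qed

lemma AE_path_measure_nonneg: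
  assumes K: "unit_increasing F K" and \<omega>: "\<omega> \<in> space (F 0)"
    and hit [measurable]: "(\<lambda>u. hit K u \<omega>) \<in> borel_measurable borel"
  shows "AE t in path_measure K \<omega>. 0 \<le> t"
  unfolding path_measure_eq_distr[OF K \<omega> hit] by (subst AE_distr_iff) auto

text \<open>Measurability is required only after truncating the argument at 0, since nothing is
  known about a process at negative times and \<open>dK\<close> does not charge them.\<close>

lemma nn_integral_path_measure:
  assumes K: "unit_increasing F K" and \<omega>: "\<omega> \<in> space (F 0)"
    and hit [measurable]: "(\<lambda>u. hit K u \<omega>) \<in> borel_measurable borel"
    and f: "(\<lambda>t. f (max 0 t)) \<in> borel_measurable borel"
  shows "(\<integral>\<^sup>+t. f t \<partial>path_measure K \<omega>) =
    (\<integral>\<^sup>+u. indicator {u. 0 < u \<and> hit K u \<omega> < \<top>} u * f (enn2real (hit K u \<omega>)) \<partial>lborel)"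
proof -
  have [measurable]: "{u. 0 < u \<and> hit K u \<omega> < \<top>} \<in> sets borel" by measurable
  note f [measurable]
  have [measurable]: "(\<lambda>u. f (enn2real (hit K u \<omega>))) \<in> borel_measurable borel"
    using measurable_compose[OF borel_measurable_enn2real[OF hit] f] by (simp add: max_absorb2)
  have "(\<integral>\<^sup>+t. f t \<partial>path_measure K \<omega>) = (\<integral>\<^sup>+t. f (max 0 t) \<partial>path_measure K \<omega>)"
    using AE_path_measure_nonneg[OF K \<omega> hit]
    by (intro nn_integral_cong_AE) (auto simp: max_absorb2 elim!: eventually_mono)
  also have "\<dots> = (\<integral>\<^sup>+u. indicator {u. 0 < u \<and> hit K u \<omega> < \<top>} u *
      f (max 0 (enn2real (hit K u \<omega>))) \<partial>lborel)"
    unfolding path_measure_eq_distr[OF K \<omega> hit]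
    by (subst nn_integral_distr, simp, simp, subst nn_integral_density) simp_all
  finally show ?thesis by (simp add: max_absorb2)
qed

lemma hit_eq_top:
  assumes K: "unit_increasing F K" and \<omega>: "\<omega> \<in> space (F 0)" and u: "1 < u"
  shows "hit K u \<omega> = \<top>"
proof -
  have "{t. 0 \<le> t \<and> u \<le> K t \<omega>} = {}"
    using K \<omega> u by (force simp: unit_increasing_def)
  then show ?thesis by (simp add: hit_def)
qed

section \<open>Integrals with respect to the constant martingale\<close>

lemma ucp_limit_zero: "ucp_limit M (\<lambda>n t \<omega>. 0) (\<lambda>t \<omega>. 0)"
  unfolding ucp_limit_def by (intro allI impI exI[of _ "\<lambda>_. {}"]) auto

text \<open>An elementary integral multiplies increments of the integrator, and those of the
  constant 1 vanish.\<close>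

lemma stoch_integral_const_sum:
  fixes n :: nat
  assumes "\<And>k. k < n \<Longrightarrow> 0 \<le> a k \<and> a k \<le> b k"
    and "\<And>k. k < n \<Longrightarrow> Z k \<in> borel_measurable (F (ennreal (a k)))"
    and "\<And>k. k < n \<Longrightarrow> bounded (Z k ` space M)"
  shows "stoch_integral M F (\<lambda>t \<omega>. 1)
    (\<lambda>t \<omega>. \<Sum>k<n. if a k < t \<and> t \<le> b k then Z k \<omega> else 0) (\<lambda>t \<omega>. 0)"
  using assms
proof (induction n)
  case 0
  \<comment> \<open>The empty interval from 0 to 0 supplies the zero integrand.\<close>
  have "stoch_integral M F (\<lambda>t \<omega>. 1) (\<lambda>t \<omega>. if 0 < t \<and> t \<le> (0::real) then 0 else 0)
      (\<lambda>t \<omega>. 0 * (1 - 1))"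
    by (rule stoch_integral.elementary) (auto intro: bounded_subset[of "{0::real}"])
  then show ?case by simp
next
  case (Suc n)
  have "stoch_integral M F (\<lambda>t \<omega>. 1) (\<lambda>t \<omega>. if a n < t \<and> t \<le> b n then Z n \<omega> else 0)
      (\<lambda>t \<omega>. Z n \<omega> * (1 - 1))"
    by (rule stoch_integral.elementary) (use Suc.prems in auto)
  from stoch_integral.linear[OF Suc.IH this, of 1 1] Suc.prems show ?case by simp
qed

text \<open>\<open>left_limit\<close> is defined through \<open>Lim\<close>, which is meaningful
  only if the limit exists; for a bounded monotone path the limit is the supremum over earlier
  times.\<close>

lemma left_limit_tendsto:
  fixes k :: "real \<Rightarrow> real"
  assumes mono: "mono_on {0..} k" and bnd: "\<And>t. 0 \<le> t \<Longrightarrow> k t \<le> B" and t: "0 < t"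
  shows "(k \<longlongrightarrow> left_limit k t) (at_left t)"
proof -
  let ?l = "SUP s\<in>{0..<t}. k s"
  have bdd: "bdd_above (k ` {0..<t})" by (auto intro!: bdd_aboveI[of _ B] bnd)
  have "(k \<longlongrightarrow> ?l) (at_left t)"
  proof (rule increasing_tendsto)
    show "\<forall>\<^sub>F s in at_left t. k s \<le> ?l"
      using t bdd by (intro eventually_at_leftI[of 0]) (auto intro: cSUP_upper)
    fix y assume "y < ?l"
    then obtain s where s: "0 \<le> s" "s < t" "y < k s"
      using less_cSUP_iff[OF _ bdd] t by auto
    then show "\<forall>\<^sub>F x in at_left t. y < k x"
      by (intro eventually_at_leftI[of s]) (auto intro: less_le_trans[OF _ mono_onD[OF mono]])
  qed
  then show ?thesis using t by (simp add: left_limit_def tendsto_Lim)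
qed

text \<open>Ceiling minus one gives the last dyadic point strictly before \<open>t\<close>.
  Strictness matters, as a path may jump at \<open>t\<close>.\<close>

lemma grid_tendsto_at_left:
  fixes t :: real
  shows "filterlim (\<lambda>n. (of_int \<lceil>t * 2 ^ n\<rceil> - 1) / 2 ^ n) (at_left t) sequentially"
proof -
  have lt: "(of_int \<lceil>t * 2 ^ n\<rceil> - 1) / 2 ^ n < t" for n
    by (simp add: pos_divide_less_eq) linarith
  have ge: "t - 1 / 2 ^ n \<le> (of_int \<lceil>t * 2 ^ n\<rceil> - 1) / 2 ^ n" for n :: nat
    by (simp add: pos_le_divide_eq left_diff_distrib)
  have "(\<lambda>n. (of_int \<lceil>t * 2 ^ n\<rceil> - 1) / 2 ^ n) \<longlonglongrightarrow> t"
  proof (rule real_tendsto_sandwich)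
    show "(\<lambda>n. t - 1 / 2 ^ n) \<longlonglongrightarrow> t"
      using tendsto_diff[OF tendsto_const LIMSEQ_inverse_realpow_zero[of 2], of t]
      by (simp add: field_simps)
  qed (use lt ge in \<open>auto intro!: always_eventually less_imp_le\<close>)
  then show ?thesis
    unfolding filterlim_at
    using lt by (intro conjI always_eventually) (auto simp: less_imp_neq)
qed

text \<open>The left-open dyadic intervals in the sum partition \<open>{0<..n}\<close>, so exactly
  one term survives, namely that of the interval containing \<open>t\<close>.\<close>

lemma grid_sum:
  fixes z :: "nat \<Rightarrow> real"
  assumes t: "0 < t" "t \<le> real n"
  shows "(\<Sum>k<n * 2 ^ n. if real k / 2 ^ n < t \<and> t \<le> real (Suc k) / 2 ^ n then z k else 0) =
    z (nat (\<lceil>t * 2 ^ n\<rceil> - 1))"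
proof -
  define j where "j = nat (\<lceil>t * 2 ^ n\<rceil> - 1)"
  have pos: "0 < t * 2 ^ n" using t by simp
  have j: "real j = of_int \<lceil>t * 2 ^ n\<rceil> - 1"
    unfolding j_def using pos by (simp add: of_nat_nat)
  have "t * 2 ^ n \<le> real (n * 2 ^ n)" using t by simp
  then have "\<lceil>t * 2 ^ n\<rceil> \<le> int (n * 2 ^ n)" by (simp add: ceiling_le_iff)
  then have "real j < real (n * 2 ^ n)" unfolding j by linarith
  then have jn: "j < n * 2 ^ n" by linarith
  have iff: "real k / 2 ^ n < t \<and> t \<le> real (Suc k) / 2 ^ n \<longleftrightarrow> k = j" for k
  proof -
    have "real k / 2 ^ n < t \<and> t \<le> real (Suc k) / 2 ^ n \<longleftrightarrow>
        real k < t * 2 ^ n \<and> t * 2 ^ n \<le> real k + 1"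
      by (simp add: pos_divide_less_eq pos_le_divide_eq add.commute)
    also have "\<dots> \<longleftrightarrow> \<lceil>t * 2 ^ n\<rceil> = int k + 1"
      by (auto simp: ceiling_eq_iff)
    also have "\<dots> \<longleftrightarrow> real k = real j" unfolding j by linarith
    finally show ?thesis by simp
  qed
  show ?thesis
    unfolding iff using jn by (simp add: j_def[symmetric])
qed

text \<open>
  The indicator of \<open>K\<^sub>t\<^sub>- = 1\<close> is the limit of the powers \<open>K\<^sub>t\<^sub>-\<^sup>m\<close>, which are limits of
  elementary processes.
\<close>

lemma stoch_integral_left_limit_power:
  assumes K: "unit_increasing F K" and sp: "space M = space (F 0)"
  shows "stoch_integral M F (\<lambda>t \<omega>. 1)
    (\<lambda>t \<omega>. if t \<le> 0 then 0 else left_limit (\<lambda>s. K s \<omega>) t ^ m) (\<lambda>t \<omega>. 0)"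
proof (rule stoch_integral.limit)
  \<comment> \<open>Each interval carries the value of \<open>K\<close> at its left end point. This
    value is known at the start of the interval, as an elementary integrand requires, and it
    converges to the left limit as the grid is refined.\<close>
  let ?H = "\<lambda>n t \<omega>. \<Sum>k<n * 2 ^ n. if real k / 2 ^ n < t \<and> t \<le> real (Suc k) / 2 ^ n
      then K (real k / 2 ^ n) \<omega> ^ m else 0"
  have bnd: "0 \<le> t \<Longrightarrow> \<omega> \<in> space M \<Longrightarrow> 0 \<le> K t \<omega> \<and> K t \<omega> \<le> 1" for t \<omega>
    using K sp by (auto simp: unit_increasing_def)
  show "stoch_integral M F (\<lambda>t \<omega>. 1) (?H n) (\<lambda>t \<omega>. 0)" for n
  proof (rule stoch_integral_const_sum)
    fix k
    show "0 \<le> real k / 2 ^ n \<and> real k / 2 ^ n \<le> real (Suc k) / 2 ^ n"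
      by (auto intro: divide_right_mono)
    show "(\<lambda>\<omega>. K (real k / 2 ^ n) \<omega> ^ m) \<in> borel_measurable (F (ennreal (real k / 2 ^ n)))"
      using K by (intro borel_measurable_power) (simp add: unit_increasing_def adapted_def)
    show "bounded ((\<lambda>\<omega>. K (real k / 2 ^ n) \<omega> ^ m) ` space M)"
      using bnd by (auto simp: bounded_iff power_abs intro!: exI[of _ 1] power_le_one)
  qed
  have ge0: "0 \<le> ?H n t \<omega>" if "\<omega> \<in> space M" for n t \<omega>
    using bnd that by (intro sum_nonneg) auto
  have H_eq: "?H n t \<omega> = K ((of_int \<lceil>t * 2 ^ n\<rceil> - 1) / 2 ^ n) \<omega> ^ m"
    if "0 < t" "t \<le> real n" for n t \<omega>
  proof -
    have "0 < t * 2 ^ n" using that by simp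
    then have "real (nat (\<lceil>t * 2 ^ n\<rceil> - 1)) = of_int \<lceil>t * 2 ^ n\<rceil> - 1" by (simp add: of_nat_nat)
    then show ?thesis
      using grid_sum[OF that, where z="\<lambda>k. K (real k / 2 ^ n) \<omega> ^ m"] by simp
  qed
  have H_zero: "?H n t \<omega> = 0" if "\<not> (0 < t \<and> t \<le> real n)" for n t \<omega>
  proof (rule sum.neutral, intro ballI)
    fix k assume "k \<in> {..<n * 2 ^ n}"
    then have "real (Suc k) \<le> real (n * 2 ^ n)" by (intro of_nat_mono) auto
    then have "real (Suc k) / 2 ^ n \<le> real n" by (simp add: pos_divide_le_eq)
    moreover have "0 \<le> real k / 2 ^ n" by simp
    ultimately have "\<not> (real k / 2 ^ n < t \<and> t \<le> real (Suc k) / 2 ^ n)" using that by linarith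
    then show "(if real k / 2 ^ n < t \<and> t \<le> real (Suc k) / 2 ^ n
      then K (real k / 2 ^ n) \<omega> ^ m else 0) = 0" by (rule if_not_P)
  qed
  show "\<bar>?H n t \<omega>\<bar> \<le> 1" if "\<omega> \<in> space M" for n t \<omega>
  proof (cases "0 < t \<and> t \<le> real n")
    case True
    then have "0 < t * 2 ^ n" by simp
    then have "0 \<le> (real_of_int \<lceil>t * 2 ^ n\<rceil> - 1) / 2 ^ n" by (simp add: zero_le_divide_iff)
    then have "0 \<le> K ((of_int \<lceil>t * 2 ^ n\<rceil> - 1) / 2 ^ n) \<omega> \<and> K ((of_int \<lceil>t * 2 ^ n\<rceil> - 1) / 2 ^ n) \<omega> \<le> 1"
      using bnd that by blast
    then show ?thesis
      using True by (subst H_eq) (auto simp: power_abs intro!: power_le_one)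
  next
    case False
    show ?thesis by (subst H_zero[OF False]) simp
  qed
  show "(\<lambda>n. ?H n t \<omega>) \<longlonglongrightarrow> (if t \<le> 0 then 0 else left_limit (\<lambda>s. K s \<omega>) t ^ m)"
    if "0 \<le> t" "\<omega> \<in> space M" for t \<omega>
  proof (cases "t \<le> 0")
    case True
    \<comment> \<open>No interval contains time 0, so the limit there is 0 even for
      \<open>m = 0\<close>.\<close>
    then show ?thesis by (subst H_zero) auto
  next
    case False
    then have t: "0 < t" by simp
    have "((\<lambda>s. K s \<omega>) \<longlongrightarrow> left_limit (\<lambda>s. K s \<omega>) t) (at_left t)"
      using K that bnd t sp by (intro left_limit_tendsto[where B=1]) (auto simp: unit_increasing_def)
    from tendsto_power[OF filterlim_compose[OF this grid_tendsto_at_left], of m]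
    have "(\<lambda>n. K ((of_int \<lceil>t * 2 ^ n\<rceil> - 1) / 2 ^ n) \<omega> ^ m) \<longlonglongrightarrow> left_limit (\<lambda>s. K s \<omega>) t ^ m" .
    moreover have "\<forall>\<^sub>F n in sequentially. K ((of_int \<lceil>t * 2 ^ n\<rceil> - 1) / 2 ^ n) \<omega> ^ m = ?H n t \<omega>"
      using eventually_ge_at_top[of "nat \<lceil>t\<rceil>"]
    proof eventually_elim
      case (elim n)
      then have "t \<le> real n" by linarith
      then show ?case using H_eq[OF t] by simp
    qed
    ultimately show ?thesis using False by (simp add: Lim_transform_eventually)
  qed
qed (rule ucp_limit_zero)

text \<open>The powers of a number in \<open>{0..1}\<close> tend to 1 if it is 1 and to 0 otherwise.
  At time 0, the only time at which the constant integrator has mass, the integrand vanishes because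
  \<open>left_limit\<close> is 0 there.\<close>

lemma stoch_integral_vanishes_one:
  assumes K: "unit_increasing F K" and sp: "space M = space (F 0)"
  shows "stoch_integral_vanishes M F (\<lambda>t \<omega>. 1)
    (\<lambda>t \<omega>. if left_limit (\<lambda>s. K s \<omega>) t = 1 then 1 else 0)"
proof -
  have l: "0 \<le> left_limit (\<lambda>s. K s \<omega>) t \<and> left_limit (\<lambda>s. K s \<omega>) t \<le> 1"
    if t: "0 < t" and \<omega>: "\<omega> \<in> space M" for t \<omega>
  proof -
    have lim: "((\<lambda>s. K s \<omega>) \<longlongrightarrow> left_limit (\<lambda>s. K s \<omega>) t) (at_left t)"
      using K \<omega> t sp by (intro left_limit_tendsto[where B=1]) (auto simp: unit_increasing_def)
    have ev: "\<forall>\<^sub>F s in at_left t. 0 \<le> K s \<omega>" "\<forall>\<^sub>F s in at_left t. K s \<omega> \<le> 1"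
      using K \<omega> t sp by (auto simp: unit_increasing_def intro!: eventually_at_leftI[of 0])
    then show ?thesis
      using tendsto_lowerbound[OF lim ev(1)] tendsto_upperbound[OF lim ev(2)] by simp
  qed
  have "stoch_integral M F (\<lambda>t \<omega>. 1)
    (\<lambda>t \<omega>. if left_limit (\<lambda>s. K s \<omega>) t = 1 then 1 else 0) (\<lambda>t \<omega>. 0)"
  proof (rule stoch_integral.limit[OF stoch_integral_left_limit_power[OF K sp]])
    fix m and t :: real and \<omega> assume "0 \<le> t" "\<omega> \<in> space M"
    then show "\<bar>if t \<le> 0 then 0 else left_limit (\<lambda>s. K s \<omega>) t ^ m\<bar> \<le> 1"
      using l[of t \<omega>] by (auto simp: power_abs intro!: power_le_one)
  next
    fix t :: real and \<omega> assume *: "0 \<le> t" "\<omega> \<in> space M"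
    show "(\<lambda>m. if t \<le> 0 then 0 else left_limit (\<lambda>s. K s \<omega>) t ^ m) \<longlonglongrightarrow>
        (if left_limit (\<lambda>s. K s \<omega>) t = 1 then 1 else 0)"
    proof (cases "t \<le> 0")
      case True
      then show ?thesis by (simp add: left_limit_def)
    next
      case False
      then show ?thesis
        using l[of t \<omega>] * by (auto intro!: LIMSEQ_realpow_zero)
    qed
  qed (rule ucp_limit_zero)
  then show ?thesis
    unfolding stoch_integral_vanishes_def by (intro exI[of _ "\<lambda>t \<omega>. 0"]) auto
qed

text \<open>The filtration is tied to \<open>P\<close> while the probability is \<open>M\<close>, so
  the lemma can be applied to another measure on the same sigma-algebra. The localising times are
  constantly infinite.\<close>

lemma local_martingale_one:
  assumes "right_continuous_filtration P F" "prob_space M" "sets M = sets P"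
  shows "local_martingale M F (\<lambda>t \<omega>. 1)"
proof -
  interpret right_continuous_filtration P F by fact
  interpret M: prob_space M by fact
  have sub: "subalgebra M (F t)" for t
    using sets_F_mono[of t \<top>] sets_F_le assms(3) sets_eq_imp_space_eq[OF assms(3)]
    by (auto simp: subalgebra_def space_F)
  have "AE \<omega> in M. real_cond_exp M (F (ennreal s)) (\<lambda>\<omega>. 1) \<omega> = 1" for s
  proof -
    interpret finite_measure_subalgebra M "F (ennreal s)"
      by unfold_locales (rule sub)
    show ?thesis by (rule real_cond_exp_F_meas) auto
  qed
  then have "martingale M F (\<lambda>t \<omega>. 1)"
    by (auto simp: martingale_def adapted_def)
  then show ?thesis
    unfolding local_martingale_def
    by (intro conjI exI[of _ "\<lambda>n \<omega>. \<top>"])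
      (auto simp: adapted_def cadlag_def stopping_time_const stopped_def incseq_def)
qed

text \<open>
  \<open>f\<close> need not be measurable: if \<open>A \<mapsto> \<integral>\<^sup>+x\<in>A. f x \<partial>M\<close> were not a measure, \<^const>\<open>density\<close>
  would be the zero measure. This avoids discussing the measurability of the limit \<open>L\<^sub>\<infinity>\<close>.
\<close>

lemma emeasure_density_nonzero:
  assumes "emeasure (density M f) (space M) \<noteq> 0" and A: "A \<in> sets M"
  shows "emeasure (density M f) A = (\<integral>\<^sup>+x. f x * indicator A x \<partial>M)"
  using assms unfolding density_def emeasure_measure_of_conv
  by (auto simp: sets.sigma_sets_eq split: if_splits)

text \<open>Restricted to \<open>S\<close>, the measures \<open>h P\<close> and \<open>Q\<close>
  agree on \<open>G\<close>, hence give the same integrals of \<open>G\<close>-measurable functions.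
  Measurability of \<open>h\<close> is asked with respect to \<open>P\<close>, so that a
  modification of \<open>L\<close> that is no longer adapted can serve as \<open>h\<close>.\<close>

lemma nn_integral_density_on_subalgebra:
  assumes P: "subalgebra P G" and Q: "subalgebra Q G"
    and h [measurable]: "h \<in> borel_measurable P" and S: "S \<in> sets G"
    and eq: "\<And>A. A \<in> sets G \<Longrightarrow> A \<subseteq> S \<Longrightarrow> emeasure Q A = (\<integral>\<^sup>+x. h x * indicator A x \<partial>P)"
    and Z [measurable]: "Z \<in> borel_measurable G"
  shows "(\<integral>\<^sup>+x. Z x * indicator S x \<partial>Q) = (\<integral>\<^sup>+x. Z x * h x * indicator S x \<partial>P)"
proof -
  have sp: "space P = space G" "space Q = space G"
    and le: "sets G \<subseteq> sets P" "sets G \<subseteq> sets Q"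
    using P Q by (auto simp: subalgebra_def)
  have [measurable]: "S \<in> sets P" "S \<in> sets Q" using S le by auto
  have [measurable]: "Z \<in> borel_measurable P" "Z \<in> borel_measurable Q"
    using Z P Q by (auto intro: measurable_from_subalg)
  let ?P = "density P (\<lambda>x. h x * indicator S x)" and ?Q = "density Q (indicator S)"
  have P': "subalgebra ?P G" and Q': "subalgebra ?Q G"
    using P Q by (auto simp: subalgebra_def)
  have "restr_to_subalg ?P G = restr_to_subalg ?Q G"
  proof (rule measure_eqI)
    fix A assume "A \<in> sets (restr_to_subalg ?P G)"
    then have A: "A \<in> sets G" using P' by (simp add: sets_restr_to_subalg)
    then have [measurable]: "A \<in> sets P" "A \<in> sets Q" using le by auto
    have "emeasure ?P A = (\<integral>\<^sup>+x. h x * indicator (A \<inter> S) x \<partial>P)"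
      by (subst emeasure_density) (auto intro!: nn_integral_cong split: split_indicator)
    also have "\<dots> = emeasure Q (A \<inter> S)" using A S by (intro eq[symmetric]) auto
    also have "\<dots> = emeasure ?Q A"
      by (subst emeasure_density) (auto intro!: nn_integral_cong simp flip: nn_integral_indicator split: split_indicator)
    finally show "emeasure (restr_to_subalg ?P G) A = emeasure (restr_to_subalg ?Q G) A"
      using A P' Q' by (simp add: emeasure_restr_to_subalg)
  qed (use P' Q' in \<open>simp add: sets_restr_to_subalg\<close>)
  then have "(\<integral>\<^sup>+x. Z x \<partial>?P) = (\<integral>\<^sup>+x. Z x \<partial>?Q)"
    using nn_integral_subalgebra2[OF P' Z] nn_integral_subalgebra2[OF Q' Z] by simp
  then show ?thesis
    by (simp add: nn_integral_density ac_simps)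
qed

section \<open>Change of time under an expectation\<close>

context right_continuous_filtration
begin

text \<open>The pathwise substitution is followed by Tonelli's theorem. The measure \<open>R\<close>
  is kept general because both \<open>P\<close> and \<open>Q\<close> are used.\<close>

lemma nn_integral_path_measure_time_change:
  assumes K: "unit_increasing F K" and R: "sigma_finite_measure R" "sets R = sets M"
    and G: "(\<lambda>x. G (max 0 (fst x)) (snd x)) \<in> borel_measurable (borel \<Otimes>\<^sub>M R)"
  shows "(\<integral>\<^sup>+\<omega>. (\<integral>\<^sup>+t. G t \<omega> \<partial>path_measure K \<omega>) \<partial>R) =
    (\<integral>\<^sup>+u\<in>{0<..<1}. (\<integral>\<^sup>+\<omega>. G (enn2real (hit K u \<omega>)) \<omega> * indicator {\<omega>. hit K u \<omega> < \<top>} \<omega> \<partial>R) \<partial>lborel)"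
proof -
  interpret R: sigma_finite_measure R by fact
  interpret pair_sigma_finite lborel R ..
  have id: "(\<lambda>\<omega>. \<omega>) \<in> R \<rightarrow>\<^sub>M F \<top>"
    using sets_F_le R(2) sets_eq_imp_space_eq[OF R(2)] by (auto simp: measurable_def space_F)
  have spR: "space R = space (F 0)"
    using sets_eq_imp_space_eq[OF R(2)] by (simp add: space_F)
  have hit [measurable]: "(\<lambda>x. hit K (fst x) (snd x)) \<in> borel_measurable (lborel \<Otimes>\<^sub>M R)"
    by (rule measurable_hit[OF K measurable_compose[OF measurable_snd id]]) simp
  have [measurable]: "(\<lambda>x. G (enn2real (hit K (fst x) (snd x))) (snd x)) \<in> borel_measurable (lborel \<Otimes>\<^sub>M R)"
    using measurable_compose[OF measurable_Pair[OF borel_measurable_enn2real[OF hit] measurable_snd] G]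
    by (simp add: max_absorb2)
  have "(\<integral>\<^sup>+\<omega>. (\<integral>\<^sup>+t. G t \<omega> \<partial>path_measure K \<omega>) \<partial>R) =
      (\<integral>\<^sup>+\<omega>. (\<integral>\<^sup>+u. indicator {u. 0 < u \<and> hit K u \<omega> < \<top>} u * G (enn2real (hit K u \<omega>)) \<omega> \<partial>lborel) \<partial>R)"
  proof (intro nn_integral_cong nn_integral_path_measure[OF K])
    fix \<omega> assume \<omega>: "\<omega> \<in> space R"
    then show "\<omega> \<in> space (F 0)" using spR by simp
    then show "(\<lambda>u. hit K u \<omega>) \<in> borel_measurable borel"
      by (intro measurable_hit[OF K]) (auto simp: space_F)
    show "(\<lambda>t. G (max 0 t) \<omega>) \<in> borel_measurable borel"
      using measurable_compose[OF measurable_Pair2'[OF \<omega>] G] by simp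
  qed
  also have "\<dots> = (\<integral>\<^sup>+u. (\<integral>\<^sup>+\<omega>. indicator {u. 0 < u \<and> hit K u \<omega> < \<top>} u * G (enn2real (hit K u \<omega>)) \<omega> \<partial>R) \<partial>lborel)"
    by (rule Fubini') (simp add: split_beta' indicator_def)
  \<comment> \<open>Levels at most 0 are cut off by the indicator and levels above 1 are never
    reached. Level 1 may be reached but is a null set; it has to go because the agreement of the
    measures is given for levels below 1 only.\<close>
  also have "\<dots> = (\<integral>\<^sup>+u\<in>{0<..<1}. (\<integral>\<^sup>+\<omega>. G (enn2real (hit K u \<omega>)) \<omega> *
      indicator {\<omega>. hit K u \<omega> < \<top>} \<omega> \<partial>R) \<partial>lborel)"
  proof (intro nn_integral_cong_AE eventually_mono[OF AE_lborel_singleton[of 1]])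
    fix u :: real assume "u \<noteq> 1"
    then consider "u \<le> 0" | "1 < u" | "0 < u" "u < 1" by linarith
    then show "(\<integral>\<^sup>+\<omega>. indicator {u. 0 < u \<and> hit K u \<omega> < \<top>} u * G (enn2real (hit K u \<omega>)) \<omega> \<partial>R) =
      (\<integral>\<^sup>+\<omega>. G (enn2real (hit K u \<omega>)) \<omega> * indicator {\<omega>. hit K u \<omega> < \<top>} \<omega> \<partial>R) * indicator {0<..<1} u"
    proof cases
      case 2
      then have "hit K u \<omega> = \<top>" if "\<omega> \<in> space R" for \<omega>
        using hit_eq_top[OF K] that spR by simp
      then show ?thesis using 2 by (simp cong: nn_integral_cong)
    next
      case 3
      then show ?thesis
        by (auto intro!: nn_integral_cong split: split_indicator)
    qed simp
  qed
  finally show ?thesis .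
qed

end

section \<open>The change of measure\<close>

locale random_time_change_of_measure = right_continuous_filtration P F + P: prob_space P + Q: prob_space Q
  for P Q :: "'a measure" and F :: "ennreal \<Rightarrow> 'a measure" +
  fixes \<rho> :: "'a \<Rightarrow> ennreal" and K L :: "real \<Rightarrow> 'a \<Rightarrow> real" and U :: "'a \<Rightarrow> real"
  assumes canonical: "canonical_pair P F \<rho> K L"
    and sets_Q: "sets Q = sets P"
    and Q_eq: "u \<in> {0..<1} \<Longrightarrow> A \<in> sets (pre_sigma (hit K u)) \<Longrightarrow>
      emeasure Q A = emeasure (density P (\<lambda>\<omega>. ennreal (value_at L (hit K u) \<omega>))) A"
    and uniform: "independent_uniform Q F U"
begin

lemma K: "unit_increasing F K"
  using canonical by (simp add: canonical_pair_def)

lemma space_Q: "space Q = space P"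
  using sets_Q by (rule sets_eq_imp_space_eq)

lemma measurable_P_F: "(\<lambda>\<omega>. \<omega>) \<in> P \<rightarrow>\<^sub>M F \<top>" and measurable_Q_F: "(\<lambda>\<omega>. \<omega>) \<in> Q \<rightarrow>\<^sub>M F \<top>"
  using sets_F_le by (auto simp: measurable_def space_F space_Q sets_Q)

lemma measurable_U [measurable]: "U \<in> borel_measurable Q"
  using uniform by (simp add: independent_uniform_def)

lemma subalgebra_pre_sigma: "subalgebra P (pre_sigma (hit K u))" "subalgebra Q (pre_sigma (hit K u))"
proof -
  have "sets (pre_sigma (hit K u)) \<subseteq> sets (F \<top>)"
    \<comment> \<open>At time \<top> the defining condition of \<open>pre_sigma\<close> puts the set
      itself into \<open>F \<top>\<close>.\<close>
    using sets_pre_sigmaD[OF stopping_time_hit[OF K], of _ _ \<top>] by force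
  then show "subalgebra P (pre_sigma (hit K u))" "subalgebra Q (pre_sigma (hit K u))"
    using sets_F_le by (auto simp: subalgebra_def space_pre_sigma space_Q sets_Q)
qed

text \<open>
  \<open>L'\<close> is in general no longer adapted to \<open>F\<close>, as \<open>F\<close> is not complete.
\<close>

lemma right_continuous_version:
  obtains L' where "\<And>r. 0 \<le> r \<Longrightarrow> L' r \<in> borel_measurable P"
    and "\<And>r \<omega>. \<omega> \<in> space P \<Longrightarrow> 0 \<le> r \<Longrightarrow> continuous (at_right r) (\<lambda>t. L' t \<omega>)"
    and "AE \<omega> in P. \<forall>t. L' t \<omega> = L t \<omega>"
proof -
  have L: "adapted F L" "AE \<omega> in P. cadlag (\<lambda>t. L t \<omega>)"
    using canonical by (auto simp: canonical_pair_def local_martingale_def)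
  from AE_E3[OF L(2)] obtain N where N: "\<And>\<omega>. \<omega> \<in> space P - N \<Longrightarrow> cadlag (\<lambda>t. L t \<omega>)"
    "N \<in> null_sets P" by blast
  show ?thesis
  proof (rule that[of "\<lambda>t \<omega>. if \<omega> \<in> N then 0 else L t \<omega>"])
    fix r :: real assume r: "0 \<le> r"
    then have "L r \<in> borel_measurable P"
      using L(1) by (auto simp: adapted_def intro: measurable_F_M)
    then show "(\<lambda>\<omega>. if \<omega> \<in> N then 0 else L r \<omega>) \<in> borel_measurable P"
      using N(2) by (intro measurable_If_set) auto
    show "continuous (at_right r) (\<lambda>t. if \<omega> \<in> N then 0 else L t \<omega>)" if "\<omega> \<in> space P" for \<omega>
      using cadlag_at_right[OF N(1)] that r by (cases "\<omega> \<in> N") auto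
  next
    show "AE \<omega> in P. \<forall>t. (if \<omega> \<in> N then 0 else L t \<omega>) = L t \<omega>"
      using AE_not_in[OF N(2)] by eventually_elim simp
  qed
qed

text \<open>The indicator removes the outcomes with infinite hitting time, where
  \<open>enn2real\<close> would silently select the value at time 0.\<close>

definition time_changed :: "(real \<Rightarrow> 'a \<Rightarrow> real) \<Rightarrow> real \<Rightarrow> 'a \<Rightarrow> ennreal" where
  "time_changed V u \<omega> = ennreal (V (enn2real (hit K u \<omega>)) \<omega>) * indicator {\<omega>. hit K u \<omega> < \<top>} \<omega>"

text \<open>The value of \<open>V\<close> at \<open>hit K u\<close> is measurable at that stopping
  time, where \<open>Q\<close> has the density given by \<open>L\<close>. Restricting to finite
  hitting times keeps the limit of \<open>L\<close> at infinity out of the formula.\<close>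

lemma nn_integral_Q_hit:
  assumes V: "optional_process F V" and u: "u \<in> {0..<1}"
    and L'_meas: "\<And>r. 0 \<le> r \<Longrightarrow> L' r \<in> borel_measurable P"
    and L'_cont: "\<And>r \<omega>. \<omega> \<in> space P \<Longrightarrow> 0 \<le> r \<Longrightarrow> continuous (at_right r) (\<lambda>t. L' t \<omega>)"
    and L': "AE \<omega> in P. \<forall>t. L' t \<omega> = L t \<omega>"
  shows "(\<integral>\<^sup>+\<omega>. time_changed V u \<omega> \<partial>Q) =
    (\<integral>\<^sup>+\<omega>. ennreal (V (enn2real (hit K u \<omega>)) \<omega>) * ennreal (L' (enn2real (hit K u \<omega>)) \<omega>) *
      indicator {\<omega>. hit K u \<omega> < \<top>} \<omega> \<partial>P)"
proof -
  let ?G = "pre_sigma (hit K u)" and ?S = "{\<omega> \<in> space P. hit K u \<omega> < \<top>}"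
  note st = stopping_time_hit[OF K, of u]
  have hit: "hit K u \<in> borel_measurable ?G"
    by (rule measurable_stopping_time_pre_sigma[OF st])
  have S: "?S \<in> sets ?G"
    using measurable_sets[OF hit, of "{..<\<top>}"] by (simp add: vimage_def Int_def space_pre_sigma conj_commute)
  have Z: "(\<lambda>\<omega>. ennreal (V (enn2real (hit K u \<omega>)) \<omega>)) \<in> borel_measurable ?G"
    using measurable_compose[OF measurable_pre_sigma_optional_sigma[OF st] V[unfolded optional_process_def]]
    by simp
  have hP: "hit K u \<in> borel_measurable P"
    using measurable_hit[OF K measurable_P_F] by simp
  have h: "(\<lambda>\<omega>. ennreal (L' (enn2real (hit K u \<omega>)) \<omega>)) \<in> borel_measurable P"
    using measurable_right_continuous_process[of L' P, OF L'_meas L'_cont measurable_ident_sets[OF refl]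
      borel_measurable_enn2real[OF hP]] by simp
  \<comment> \<open>The whole space belongs to \<open>?G\<close>, so the density has the total mass
    1 of \<open>Q\<close>. It is therefore not the degenerate zero measure, and its integral formula
    is available.\<close>
  have "space P \<in> sets ?G"
    using sets.top[of ?G] by (simp add: space_pre_sigma)
  from Q_eq[OF u this] have dens: "emeasure (density P (\<lambda>\<omega>. ennreal (value_at L (hit K u) \<omega>))) (space P) \<noteq> 0"
    using Q.emeasure_space_1 by (simp add: space_Q)
  have "(\<integral>\<^sup>+\<omega>. ennreal (V (enn2real (hit K u \<omega>)) \<omega>) * indicator ?S \<omega> \<partial>Q) =
    (\<integral>\<^sup>+\<omega>. ennreal (V (enn2real (hit K u \<omega>)) \<omega>) * ennreal (L' (enn2real (hit K u \<omega>)) \<omega>) *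
      indicator ?S \<omega> \<partial>P)"
  proof (rule nn_integral_density_on_subalgebra[OF subalgebra_pre_sigma h S _ Z])
    fix A assume A: "A \<in> sets ?G" "A \<subseteq> ?S"
    then have "emeasure Q A = (\<integral>\<^sup>+\<omega>. ennreal (value_at L (hit K u) \<omega>) * indicator A \<omega> \<partial>P)"
      using emeasure_density_nonzero[OF dens, of A] subalgebra_pre_sigma(1)[of u] Q_eq[OF u, of A]
      unfolding subalgebra_def by (metis subsetD)
    \<comment> \<open>On \<open>A\<close> the hitting time is finite, so \<open>value_at\<close>
      takes an actual value of \<open>L\<close>, which almost surely is that of
      \<open>L'\<close>.\<close>
    also have "\<dots> = (\<integral>\<^sup>+\<omega>. ennreal (L' (enn2real (hit K u \<omega>)) \<omega>) * indicator A \<omega> \<partial>P)"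
      using L' A(2)
      by (intro nn_integral_cong_AE) (auto elim!: eventually_mono simp: value_at_def split: split_indicator)
    finally show "emeasure Q A = \<dots>" .
  qed
  moreover have "(\<integral>\<^sup>+\<omega>. time_changed V u \<omega> \<partial>Q) =
      (\<integral>\<^sup>+\<omega>. ennreal (V (enn2real (hit K u \<omega>)) \<omega>) * indicator ?S \<omega> \<partial>Q)"
    by (intro nn_integral_cong) (auto simp: time_changed_def space_Q split: split_indicator)
  moreover have "(\<integral>\<^sup>+\<omega>. ennreal (V (enn2real (hit K u \<omega>)) \<omega>) * ennreal (L' (enn2real (hit K u \<omega>)) \<omega>) *
      indicator ?S \<omega> \<partial>P) =
    (\<integral>\<^sup>+\<omega>. ennreal (V (enn2real (hit K u \<omega>)) \<omega>) * ennreal (L' (enn2real (hit K u \<omega>)) \<omega>) *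
      indicator {\<omega>. hit K u \<omega> < \<top>} \<omega> \<partial>P)"
    by (intro nn_integral_cong) (auto split: split_indicator)
  ultimately show ?thesis by (simp only:)
qed

text \<open>\<open>L\<close> is first replaced by the everywhere right-continuous \<open>L'\<close>,
  whose joint measurability in time and outcome permits the change of time under \<open>P\<close>.
  For each level the change of measure then leads to \<open>Q\<close>.\<close>

lemma expectation_L_dK:
  assumes V: "optional_process F V" and V0: "\<And>t \<omega>. 0 \<le> t \<Longrightarrow> \<omega> \<in> space P \<Longrightarrow> 0 \<le> V t \<omega>"
  shows "(\<integral>\<^sup>+\<omega>. (\<integral>\<^sup>+t. ennreal (V t \<omega> * L t \<omega>) \<partial>path_measure K \<omega>) \<partial>P) =
    (\<integral>\<^sup>+u\<in>{0<..<1}. (\<integral>\<^sup>+\<omega>. time_changed V u \<omega> \<partial>Q) \<partial>lborel)"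
proof -
  obtain L' :: "real \<Rightarrow> 'a \<Rightarrow> real" where L'_meas: "\<And>r. 0 \<le> r \<Longrightarrow> L' r \<in> borel_measurable P"
    and L'_cont: "\<And>r \<omega>. \<omega> \<in> space P \<Longrightarrow> 0 \<le> r \<Longrightarrow> continuous (at_right r) (\<lambda>t. L' t \<omega>)"
    and L': "AE \<omega> in P. \<forall>t. L' t \<omega> = L t \<omega>"
    by (rule right_continuous_version) (rule that)
  have hit: "(\<lambda>u. hit K u \<omega>) \<in> borel_measurable borel" if "\<omega> \<in> space P" for \<omega>
    using that by (intro measurable_hit[OF K]) (auto simp: space_F)
  have [measurable]: "(\<lambda>x. V (max 0 (fst x)) (snd x)) \<in> borel_measurable (borel \<Otimes>\<^sub>M P)"
    by (rule measurable_optional_process[OF V measurable_compose[OF measurable_snd measurable_P_F]]) auto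
  have [measurable]: "(\<lambda>x. L' (max 0 (fst x)) (snd x)) \<in> borel_measurable (borel \<Otimes>\<^sub>M P)"
    by (rule measurable_right_continuous_process[of L' P, OF L'_meas L'_cont]) auto
  have "(\<integral>\<^sup>+\<omega>. (\<integral>\<^sup>+t. ennreal (V t \<omega> * L t \<omega>) \<partial>path_measure K \<omega>) \<partial>P) =
    (\<integral>\<^sup>+\<omega>. (\<integral>\<^sup>+t. ennreal (V t \<omega>) * ennreal (L' t \<omega>) \<partial>path_measure K \<omega>) \<partial>P)"
  proof (intro nn_integral_cong_AE, use L' AE_space in eventually_elim, intro nn_integral_cong_AE)
    fix \<omega> assume *: "\<forall>t. L' t \<omega> = L t \<omega>" "\<omega> \<in> space P"
    have "AE t in path_measure K \<omega>. 0 \<le> t"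
      by (rule AE_path_measure_nonneg[OF K _ hit]) (use * in \<open>auto simp: space_F\<close>)
    then show "AE t in path_measure K \<omega>. ennreal (V t \<omega> * L t \<omega>) = ennreal (V t \<omega>) * ennreal (L' t \<omega>)"
      by eventually_elim (use * V0 in \<open>auto simp: ennreal_mult'\<close>)
  qed
  also have "\<dots> = (\<integral>\<^sup>+u\<in>{0<..<1}. (\<integral>\<^sup>+\<omega>. ennreal (V (enn2real (hit K u \<omega>)) \<omega>) *
      ennreal (L' (enn2real (hit K u \<omega>)) \<omega>) * indicator {\<omega>. hit K u \<omega> < \<top>} \<omega> \<partial>P) \<partial>lborel)"
    by (rule nn_integral_path_measure_time_change[OF K]) (auto intro: P.sigma_finite_measure_axioms)
  also have "\<dots> = (\<integral>\<^sup>+u\<in>{0<..<1}. (\<integral>\<^sup>+\<omega>. time_changed V u \<omega> \<partial>Q) \<partial>lborel)"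
    using nn_integral_Q_hit[OF V _ L'_meas L'_cont L']
    by (intro nn_integral_cong) (auto split: split_indicator)
  finally show ?thesis .
qed

lemma expectation_dK:
  assumes V: "optional_process F V"
  shows "(\<integral>\<^sup>+\<omega>. (\<integral>\<^sup>+t. ennreal (V t \<omega>) \<partial>path_measure K \<omega>) \<partial>Q) =
    (\<integral>\<^sup>+u\<in>{0<..<1}. (\<integral>\<^sup>+\<omega>. time_changed V u \<omega> \<partial>Q) \<partial>lborel)"
  unfolding time_changed_def
proof (rule nn_integral_path_measure_time_change[OF K Q.sigma_finite_measure_axioms sets_Q])
  have [measurable]: "(\<lambda>x. V (max 0 (fst x)) (snd x)) \<in> borel_measurable (borel \<Otimes>\<^sub>M Q)"
    by (rule measurable_optional_process[OF V measurable_compose[OF measurable_snd measurable_Q_F]]) auto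
  show "(\<lambda>x. ennreal (V (max 0 (fst x)) (snd x))) \<in> borel_measurable (borel \<Otimes>\<^sub>M Q)"
    by measurable
qed

text \<open>\<open>time_changed V u\<close> depends on the outcome only through
  \<open>F \<top>\<close>, of which \<open>U\<close> is independent. Integrating over the joint law
  of \<open>U\<close> and the outcome therefore amounts to averaging over a uniform level.\<close>

lemma expectation_time_changed_U:
  assumes V: "optional_process F V"
  shows "(\<integral>\<^sup>+\<omega>. time_changed V (U \<omega>) \<omega> \<partial>Q) =
    (\<integral>\<^sup>+u\<in>{0<..<1}. (\<integral>\<^sup>+\<omega>. time_changed V u \<omega> \<partial>Q) \<partial>lborel)"
proof -
  let ?I = "\<lambda>\<omega>::'a. \<omega>"
  interpret QF: prob_space "distr Q (F \<top>) ?I"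
    by (rule Q.prob_space_distr[OF measurable_Q_F])
  note [measurable] = measurable_Q_F
  have hit [measurable]: "(\<lambda>x. hit K (fst x) (snd x)) \<in> borel_measurable (borel \<Otimes>\<^sub>M F \<top>)"
    by (rule measurable_hit[OF K]) auto
  have [measurable]: "(\<lambda>x. V (enn2real (hit K (fst x) (snd x))) (snd x)) \<in> borel_measurable (borel \<Otimes>\<^sub>M F \<top>)"
    by (rule measurable_optional_process[OF V]) auto
  have T: "(\<lambda>x. time_changed V (fst x) (snd x)) \<in> borel_measurable (borel \<Otimes>\<^sub>M F \<top>)"
    unfolding time_changed_def indicator_def by measurable
  have Tu: "time_changed V u \<in> borel_measurable (F \<top>)" for u
    using measurable_compose[OF measurable_Pair1'[of u borel "F \<top>"] T] by simp
  have T1: "(\<lambda>u. \<integral>\<^sup>+\<omega>. time_changed V u \<omega> \<partial>Q) \<in> borel_measurable borel"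
  proof -
    have "(\<lambda>u. \<integral>\<^sup>+\<omega>. time_changed V u \<omega> \<partial>distr Q (F \<top>) ?I) \<in> borel_measurable borel"
      using T by (intro QF.borel_measurable_nn_integral) (simp add: split_beta' cong: measurable_cong_sets)
    then show ?thesis by (simp add: nn_integral_distr Tu)
  qed
  interpret U: prob_space "distr Q borel U" by (rule Q.prob_space_distr) simp
  \<comment> \<open>The identity, viewed as a map into \<open>F \<top>\<close>, plays the part of a
    random variable. On rectangles the equality of the laws is exactly the independence of
    \<open>U\<close> from \<open>F \<top>\<close>.\<close>
  have joint: "distr Q borel U \<Otimes>\<^sub>M distr Q (F \<top>) ?I = distr Q (borel \<Otimes>\<^sub>M F \<top>) (\<lambda>\<omega>. (U \<omega>, \<omega>))"
  proof (rule pair_measure_eqI)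
    fix A B assume "A \<in> sets (distr Q borel U)" "B \<in> sets (distr Q (F \<top>) ?I)"
    then have A: "A \<in> sets borel" and B: "B \<in> sets (F \<top>)" by simp_all
    then have "B \<subseteq> space Q" using sets.sets_into_space[OF B] by (simp add: space_F space_Q)
    then have "emeasure (distr Q borel U) A * emeasure (distr Q (F \<top>) ?I) B =
        emeasure Q (U -` A \<inter> space Q) * emeasure Q B"
      using A B by (simp add: emeasure_distr Int_absorb2)
    also have "\<dots> = emeasure Q ((U -` A \<inter> space Q) \<inter> B)"
    proof -
      have "Q.indep_set {U -` B \<inter> space Q | B. B \<in> sets borel} (sets (F \<top>))"
        using uniform by (simp add: independent_uniform_def)
      then have "Q.prob ((U -` A \<inter> space Q) \<inter> B) = Q.prob (U -` A \<inter> space Q) * Q.prob B"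
        by (rule Q.indep_setD) (use A B in blast)+
      then show ?thesis
        by (simp add: Q.emeasure_eq_measure ennreal_mult)
    qed
    also have "(U -` A \<inter> space Q) \<inter> B = (\<lambda>\<omega>. (U \<omega>, \<omega>)) -` (A \<times> B) \<inter> space Q"
      by auto
    also have "emeasure Q \<dots> = emeasure (distr Q (borel \<Otimes>\<^sub>M F \<top>) (\<lambda>\<omega>. (U \<omega>, \<omega>))) (A \<times> B)"
      using A B by (intro emeasure_distr[symmetric]) auto
    finally show "emeasure (distr Q borel U) A * emeasure (distr Q (F \<top>) ?I) B = \<dots>" .
  qed (simp_all add: U.sigma_finite_measure_axioms QF.sigma_finite_measure_axioms cong: sets_pair_measure_cong)
  have "distr Q borel U = distr Q lborel U" by (rule distr_cong) auto
  then have U: "distr Q borel U = uniform_measure lborel {0..1}"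
    using uniform by (simp add: independent_uniform_def)
  have "(\<integral>\<^sup>+\<omega>. time_changed V (U \<omega>) \<omega> \<partial>Q) =
      (\<integral>\<^sup>+x. time_changed V (fst x) (snd x) \<partial>(distr Q borel U \<Otimes>\<^sub>M distr Q (F \<top>) ?I))"
    unfolding joint using T by (subst nn_integral_distr) simp_all
  also have "\<dots> = (\<integral>\<^sup>+u. (\<integral>\<^sup>+\<omega>. time_changed V u \<omega> \<partial>distr Q (F \<top>) ?I) \<partial>distr Q borel U)"
    using T by (subst QF.nn_integral_fst[symmetric]) (simp_all cong: measurable_cong_sets)
  also have "\<dots> = (\<integral>\<^sup>+u. (\<integral>\<^sup>+\<omega>. time_changed V u \<omega> \<partial>Q) \<partial>uniform_measure lborel {0..1})"
    unfolding U by (simp add: nn_integral_distr Tu)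
  also have "\<dots> = (\<integral>\<^sup>+u\<in>{0..1}. (\<integral>\<^sup>+\<omega>. time_changed V u \<omega> \<partial>Q) \<partial>lborel)"
    using T1 by (subst nn_integral_uniform_measure) (simp_all add: divide_ennreal_def)
  also have "\<dots> = (\<integral>\<^sup>+u\<in>{0<..<1}. (\<integral>\<^sup>+\<omega>. time_changed V u \<omega> \<partial>Q) \<partial>lborel)"
  proof (rule nn_integral_cong_AE)
    show "AE u in lborel. (\<integral>\<^sup>+\<omega>. time_changed V u \<omega> \<partial>Q) * indicator {0..1} u =
        (\<integral>\<^sup>+\<omega>. time_changed V u \<omega> \<partial>Q) * indicator {0<..<1} u"
      using AE_lborel_singleton[of "0::real"] AE_lborel_singleton[of "1::real"]
      by eventually_elim (auto split: split_indicator)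
  qed
  finally show ?thesis .
qed

end

lemma enn2real_min:
  assumes "\<tau> < \<top>" "0 \<le> t"
  shows "enn2real (min \<tau> (ennreal t)) = min (enn2real \<tau>) t"
  using assms by (cases \<tau>) (auto simp: min_def)

text \<open>These are the test processes for the finite-dimensional distributions: at a finite
  random time they indicate that the values of the stopped \<open>Y\<close> at the times in
  \<open>J\<close> lie in \<open>A\<close>.\<close>

lemma optional_process_indicator_stopped:
  assumes filt: "right_continuous_filtration M F" and Y: "optional_process F Y"
    and J: "J \<subseteq> {0..}" and A: "A \<in> sets (\<Pi>\<^sub>M t\<in>J. borel)"
  shows "optional_process F (\<lambda>s \<omega>. indicator A (\<lambda>t\<in>J. Y (min s t) \<omega>))"
proof -
  interpret right_continuous_filtration M F by fact
  have "(\<lambda>x. Y (min (snd x) t) (fst x)) \<in> borel_measurable (optional_sigma F)" if "t \<in> J" for t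
    using measurable_compose[OF measurable_min_optional_sigma[of t] Y[unfolded optional_process_def]] J that
    by auto
  then have *: "(\<lambda>x. \<lambda>t\<in>J. Y (min (snd x) t) (fst x)) \<in> optional_sigma F \<rightarrow>\<^sub>M (\<Pi>\<^sub>M t\<in>J. borel)"
    by (rule measurable_restrict)
  have ind: "(indicator A :: (real \<Rightarrow> real) \<Rightarrow> real) \<in> borel_measurable (\<Pi>\<^sub>M t\<in>J. borel)"
    using A by simp
  show ?thesis
    unfolding optional_process_def split_beta' by (rule measurable_compose[OF * ind])
qed

section \<open>Canonical pair and finite-dimensional distributions for \<psi>\<close>

context random_time_change_of_measure
begin

abbreviation \<psi> :: "'a \<Rightarrow> ennreal" where "\<psi> \<omega> \<equiv> hit K (U \<omega>) \<omega>"

lemma measurable_\<psi> [measurable]: "\<psi> \<in> borel_measurable Q"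
  by (rule measurable_hit[OF K measurable_Q_F measurable_U])

text \<open>The defining identity of the canonical pair under \<open>P\<close> brings in the
  integral of \<open>V L\<close> against \<open>dK\<close>, which is then rewritten as an average
  over levels under \<open>Q\<close>.\<close>

lemma expectation_value_at_rho:
  assumes V: "optional_process F V" and V0: "\<And>t \<omega>. 0 \<le> t \<Longrightarrow> \<omega> \<in> space P \<Longrightarrow> 0 \<le> V t \<omega>"
  shows "(\<integral>\<^sup>+\<omega>. ennreal (value_at V \<rho> \<omega>) \<partial>P) = (\<integral>\<^sup>+\<omega>. time_changed V (U \<omega>) \<omega> \<partial>Q)"
  using canonical V V0 expectation_L_dK[OF V V0] expectation_time_changed_U[OF V]
  by (simp add: canonical_pair_def)

lemma AE_psi_finite: "AE \<omega> in Q. \<psi> \<omega> < \<top>"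
proof -
  have "optional_process F (\<lambda>t \<omega>. 1)"
    by (rule optional_process_cadlag) (auto simp: adapted_def cadlag_def)
  \<comment> \<open>At an infinite time the value is the limit of a constant path, hence again
    1.\<close>
  moreover have "value_at (\<lambda>t \<omega>. 1) \<rho> \<omega> = 1" for \<omega>
    by (auto simp: value_at_def intro: tendsto_Lim)
  ultimately have "(\<integral>\<^sup>+\<omega>. time_changed (\<lambda>t \<omega>. 1) (U \<omega>) \<omega> \<partial>Q) = 1"
    using expectation_value_at_rho[of "\<lambda>t \<omega>. 1"] P.emeasure_space_1 by simp
  moreover have "(\<integral>\<^sup>+\<omega>. time_changed (\<lambda>t \<omega>. 1) (U \<omega>) \<omega> \<partial>Q) =
      (\<integral>\<^sup>+\<omega>. indicator {\<omega> \<in> space Q. \<psi> \<omega> < \<top>} \<omega> \<partial>Q)"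
    by (intro nn_integral_cong) (simp add: time_changed_def indicator_def)
  ultimately have "emeasure Q {\<omega> \<in> space Q. \<psi> \<omega> < \<top>} = 1" by simp
  then show ?thesis by (intro Q.AE_I_eq_1) (simp_all add: Q.emeasure_eq_measure)
qed

lemma expectation_value_at_psi:
  "(\<integral>\<^sup>+\<omega>. ennreal (value_at V \<psi> \<omega>) \<partial>Q) = (\<integral>\<^sup>+\<omega>. time_changed V (U \<omega>) \<omega> \<partial>Q)"
  using AE_psi_finite
  by (intro nn_integral_cong_AE) (auto elim!: eventually_mono simp: value_at_def time_changed_def)

text \<open>With \<open>L = 1\<close> both sides of the defining identity reduce to the same average
  over levels in \<open>{0<..<1}\<close>.\<close>

lemma canonical_pair_psi: "canonical_pair Q F \<psi> K (\<lambda>t \<omega>. 1)"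
  unfolding canonical_pair_def
proof (intro conjI allI impI)
  show "random_time Q \<psi>"
    unfolding random_time_def using AE_psi_finite by simp
  show "local_martingale Q F (\<lambda>t \<omega>. 1)"
    using right_continuous_filtration_axioms Q.prob_space_axioms sets_Q by (rule local_martingale_one)
  show "stoch_integral_vanishes Q F (\<lambda>t \<omega>. 1) (\<lambda>t \<omega>. if left_limit (\<lambda>s. K s \<omega>) t = 1 then 1 else 0)"
    by (rule stoch_integral_vanishes_one[OF K]) (simp add: space_Q space_F)
  fix V assume "optional_process F V \<and> (\<forall>t\<ge>0. \<forall>\<omega>\<in>space Q. 0 \<le> V t \<omega>)"
  then have V: "optional_process F V" ..
  show "(\<integral>\<^sup>+\<omega>. ennreal (value_at V \<psi> \<omega>) \<partial>Q) =
    (\<integral>\<^sup>+\<omega>. (\<integral>\<^sup>+t. ennreal (V t \<omega> * 1) \<partial>path_measure K \<omega>) \<partial>Q)"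
    by (simp add: expectation_value_at_psi expectation_time_changed_U[OF V] expectation_dK[OF V])
qed (use K in auto)

lemma distr_stopped_eq:
  assumes Y: "optional_process F Y" and J: "J \<subseteq> {0..}"
  shows "distr P (\<Pi>\<^sub>M t\<in>J. borel) (\<lambda>\<omega>. \<lambda>t\<in>J. stopped Y \<rho> t \<omega>) =
    distr Q (\<Pi>\<^sub>M t\<in>J. borel) (\<lambda>\<omega>. \<lambda>t\<in>J. stopped Y \<psi> t \<omega>)"
proof (rule measure_eqI)
  have \<rho>: "\<rho> \<in> borel_measurable P" "AE \<omega> in P. \<rho> \<omega> < \<top>"
    using canonical by (auto simp: canonical_pair_def random_time_def)
  have stopped: "(\<lambda>\<omega>. \<lambda>t\<in>J. stopped Y \<tau> t \<omega>) \<in> N \<rightarrow>\<^sub>M (\<Pi>\<^sub>M t\<in>J. borel)"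
    if [measurable]: "\<tau> \<in> borel_measurable N" and "(\<lambda>\<omega>. \<omega>) \<in> N \<rightarrow>\<^sub>M F \<top>" for N \<tau>
  proof (rule measurable_restrict)
    show "stopped Y \<tau> t \<in> borel_measurable N" for t
      unfolding stopped_def[abs_def] by (rule measurable_optional_process[OF Y that(2)]) auto
  qed
  \<comment> \<open>Stated for a general pair of measure and time, as it is applied to \<rho> under
    \<open>P\<close> and to \<psi> under \<open>Q\<close>. Finiteness of the time allows the minimum
    to be taken among reals.\<close>
  have emeasure_stopped: "emeasure (distr N (\<Pi>\<^sub>M t\<in>J. borel) (\<lambda>\<omega>. \<lambda>t\<in>J. stopped Y \<tau> t \<omega>)) A =
      (\<integral>\<^sup>+\<omega>. ennreal (value_at (\<lambda>s \<omega>. indicator A (\<lambda>t\<in>J. Y (min s t) \<omega>)) \<tau> \<omega>) \<partial>N)"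
    if \<tau>: "\<tau> \<in> borel_measurable N" and fin: "AE \<omega> in N. \<tau> \<omega> < \<top>"
      and N: "(\<lambda>\<omega>. \<omega>) \<in> N \<rightarrow>\<^sub>M F \<top>" and A: "A \<in> sets (\<Pi>\<^sub>M t\<in>J. borel)" for N \<tau> A
  proof -
    have "emeasure (distr N (\<Pi>\<^sub>M t\<in>J. borel) (\<lambda>\<omega>. \<lambda>t\<in>J. stopped Y \<tau> t \<omega>)) A =
        (\<integral>\<^sup>+\<omega>. indicator A (\<lambda>t\<in>J. stopped Y \<tau> t \<omega>) \<partial>N)"
      using nn_integral_distr[OF stopped[OF \<tau> N], of "indicator A"] A by simp
    also have "\<dots> = (\<integral>\<^sup>+\<omega>. ennreal (value_at (\<lambda>s \<omega>. indicator A (\<lambda>t\<in>J. Y (min s t) \<omega>)) \<tau> \<omega>) \<partial>N)"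
    proof (intro nn_integral_cong_AE eventually_mono[OF fin])
      fix \<omega> assume "\<tau> \<omega> < \<top>"
      moreover from this have "(\<lambda>t\<in>J. stopped Y \<tau> t \<omega>) = (\<lambda>t\<in>J. Y (min (enn2real (\<tau> \<omega>)) t) \<omega>)"
        using J by (intro restrict_ext) (auto simp: stopped_def enn2real_min)
      ultimately show "indicator A (\<lambda>t\<in>J. stopped Y \<tau> t \<omega>) =
          ennreal (value_at (\<lambda>s \<omega>. indicator A (\<lambda>t\<in>J. Y (min s t) \<omega>)) \<tau> \<omega>)"
        by (simp add: value_at_def ennreal_indicator)
    qed
    finally show ?thesis .
  qed
  fix A assume "A \<in> sets (distr P (\<Pi>\<^sub>M t\<in>J. borel) (\<lambda>\<omega>. \<lambda>t\<in>J. stopped Y \<rho> t \<omega>))"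
  then have A: "A \<in> sets (\<Pi>\<^sub>M t\<in>J. borel)" by simp
  have V: "optional_process F (\<lambda>s \<omega>. indicator A (\<lambda>t\<in>J. Y (min s t) \<omega>))"
    by (rule optional_process_indicator_stopped[OF right_continuous_filtration_axioms Y J A])
  show "emeasure (distr P (\<Pi>\<^sub>M t\<in>J. borel) (\<lambda>\<omega>. \<lambda>t\<in>J. stopped Y \<rho> t \<omega>)) A =
    emeasure (distr Q (\<Pi>\<^sub>M t\<in>J. borel) (\<lambda>\<omega>. \<lambda>t\<in>J. stopped Y \<psi> t \<omega>)) A"
    unfolding emeasure_stopped[OF \<rho> measurable_P_F A]
      emeasure_stopped[OF measurable_\<psi> AE_psi_finite measurable_Q_F A]
      expectation_value_at_psi
    by (rule expectation_value_at_rho[OF V]) simp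
qed simp

end

theorem theorem2p4:
  fixes P Q :: "'a measure" and F :: "ennreal \<Rightarrow> 'a measure"
    and \<rho> \<psi> :: "'a \<Rightarrow> ennreal" and K L :: "real \<Rightarrow> 'a \<Rightarrow> real" and U :: "'a \<Rightarrow> real"
    and \<eta> :: "real \<Rightarrow> 'a \<Rightarrow> ennreal" and Qu :: "real \<Rightarrow> 'a measure"
  assumes "prob_space P"
    and "right_continuous_filtration P F"
    and "random_time P \<rho>"
    and "canonical_pair P F \<rho> K L"
    and "\<eta> = (\<lambda>u. hit K u)"
    and "Qu = (\<lambda>u. density P (\<lambda>\<omega>. ennreal (value_at L (\<eta> u) \<omega>)))"
    and "prob_space Q" and "sets Q = sets P"
    and "\<And>\<omega>. \<omega> \<in> space P \<Longrightarrow> U \<omega> \<in> {0..<1}"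
    and "\<And>u A. u \<in> {0..<1} \<Longrightarrow> A \<in> sets (filtration.pre_sigma (space P) F (\<eta> u)) \<Longrightarrow>
           emeasure Q A = emeasure (Qu u) A"
    and "independent_uniform Q F U"
    and "\<psi> = (\<lambda>\<omega>. \<eta> (U \<omega>) \<omega>)"
  shows "randomised_stopping_time Q F \<psi> \<and>
         canonical_pair Q F \<psi> K (\<lambda>t \<omega>. 1) \<and>
         (\<forall>Y. optional_process F Y \<longrightarrow> same_fdd P (stopped Y \<rho>) Q (stopped Y \<psi>))"
proof -
  interpret random_time_change_of_measure P Q F \<rho> K L U
    using assms by (simp add: random_time_change_of_measure_def random_time_change_of_measure_axioms_def)
  have \<psi>: "\<psi> = (\<lambda>\<omega>. hit K (U \<omega>) \<omega>)"
    using assms by simp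
  show ?thesis
    unfolding \<psi> randomised_stopping_time_def same_fdd_def
    using K uniform canonical_pair_psi distr_stopped_eq by blast
qed

end
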